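(* Let $\Gamma$ be a compact metric graph, let $\kappa,\tau>0$, let $L=\kappa^2-\Delta_\Gamma$ with $\Delta_\Gamma$ the Kirchhoff Laplacian on $\Gamma$, and let $\mathcal{W}$ be Gaussian white noise on $L_2(\Gamma)$. If $\alpha>\frac12$, then the equation $L^{\alpha/2}(\tau u)=\mathcal{W}$ has, $\mathbb{P}$-almost surely, a unique solution $u\in L_2(\Gamma)$.
   Context: Graph. A compact metric graph $\Gamma$ is a connected graph with a finite set $\mathcal{V}$ of vertices and a finite set $\mathcal{E}$ of edges (loops and multiple edges allowed); each edge $e$ joins a pair of vertices, has a length $\ell_e\in(0,\infty)$, and is identified with the interval $[0,\ell_e]$, its endpoints being identified with its vertices. $\mathcal{E}_v$ denotes the edges incident to $v\in\mathcal{V}$. A function $f$ on $\Gamma$ is a collection $\{f_e\}_{e\in\mathcal{E}}$ of functions on $[0,\ell_e]$. $L_2(\Gamma)=\bigoplus_{e}L_2(e)$ (Lebesgue measure on each edge); $C(\Gamma)$ is the space of continuous functions on $\Gamma$; $\widetilde H^k(\Gamma)=\bigoplus_e H^k(e)$. Operator. The Kirchhoff Laplacian $\Delta_\Gamma$ acts as $f_e\mapsto f_e''$ on each edge, with domain $\mathcal{D}(\Delta_\Gamma)=\{f\in\widetilde H^2(\Gamma)\cap C(\Gamma): \sum_{e\in\mathcal{E}_v}\partial_e f(v)=0\ \forall v\in\mathcal{V}\}$, where $\partial_e$ is the derivative along $e$ in the direction away from $v$ (a loop at $v$ contributes one term for each of its two ends). $L=\kappa^2-\Delta_\Gamma$ with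 $\mathcal{D}(L)=\mathcal{D}(\Delta_\Gamma)$ is self-adjoint, positive definite, with discrete spectrum; $\{\varphi_i\}_{i\in\mathbb{N}}$ is an $L_2(\Gamma)$-orthonormal basis of eigenfunctions with eigenvalues $0<\lambda_1\le\lambda_2\le\cdots$. For $\alpha>0$, $\dot H^\alpha=\mathcal{D}(L^{\alpha/2})=\{\phi\in L_2(\Gamma):\|\phi\|_\alpha^2:=\sum_i\lambda_i^\alpha(\phi,\varphi_i)_{L_2(\Gamma)}^2<\infty\}$ and $L^{\alpha/2}\phi=\sum_i\lambda_i^{\alpha/2}(\phi,\varphi_i)_{L_2(\Gamma)}\varphi_i$. $\dot H^{-\alpha}$ is the dual of $\dot H^\alpha$, with norm $\|\phi\|_{-\alpha}^2=\sum_i\lambda_i^{-\alpha}\langle\phi,\varphi_i\rangle^2$. $L^{\alpha/2}$ extends to $L_2(\Gamma)\to\dot H^{-\alpha}$ by $\langle L^{\alpha/2}u,\psi\rangle=(u,L^{\alpha/2}\psi)_{L_2(\Gamma)}$, $\psi\in\dot H^\alpha$. Noise. On a complete probability space $(\Omega,\mathcal{F},\mathbb{P})$, $\mathcal{W}=\sum_i\xi_i\varphi_i$ with $\xi_i$ independent standard Gaussian variables; the series converges in $L_2(\Omega;\dot H^{-s})$ for every $s>\frac12$. Equivalently, $\mathcal{W}$ is a centered Gaussian family $\{\mathcal{W}(h):h\in L_2(\Gamma)\}$ with $\mathbb{E}[\mathcal{W}(h)\mathcal{W}(g)]=(h,g)_{L_2(\Gamma)}$. *)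

theory Defs
  imports "HOL-Probability.Probability" "Graph_Theory.Digraph_Component"
begin

section \<open>Compact metric graphs\<close>

text \<open>
  The underlying multigraph (loops and parallel edges allowed) is a finite digraph whose
  orientation only fixes the parametrisation: an edge \<open>e\<close> is the interval from \<open>0\<close> (at its tail)
  to \<open>len e\<close> (at its head). Connectedness is that of the underlying undirected graph.
\<close>

locale compact_metric_graph = fin_digraph G for G :: "('v, 'e) pre_digraph" +
  fixes len :: "'e \<Rightarrow> real"
  assumes connected_graph: "Digraph_Component.connected G"
    and length_pos: "e \<in> arcs G \<Longrightarrow> len e > 0"

text \<open>
  A function on the graph is a family of functions on the edges. Values at other indices,
  or outside the interval \<open>{0..len e}\<close>, are irrelevant.
\<close>

type_synonym 'e graph_fun = "'e \<Rightarrow> real \<Rightarrow> real"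


section \<open>The space of square integrable functions\<close>

definition square_integrable :: "real \<Rightarrow> (real \<Rightarrow> real) \<Rightarrow> bool" where
  "square_integrable l f \<longleftrightarrow>
     f \<in> borel_measurable (lebesgue_on {0..l}) \<and> integrable (lebesgue_on {0..l}) (\<lambda>x. (f x)\<^sup>2)"

definition L2 :: "('v, 'e) pre_digraph \<Rightarrow> ('e \<Rightarrow> real) \<Rightarrow> 'e graph_fun set" where
  "L2 G len = {f. \<forall>e\<in>arcs G. square_integrable (len e) (f e)}"

text \<open>Elements of \<open>L2\<close> are representatives; equality in the Lebesgue space is \<open>L2_eq\<close>.\<close>

definition L2_eq ::
  "('v, 'e) pre_digraph \<Rightarrow> ('e \<Rightarrow> real) \<Rightarrow> 'e graph_fun \<Rightarrow> 'e graph_fun \<Rightarrow> bool" where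
  "L2_eq G len f g \<longleftrightarrow> (\<forall>e\<in>arcs G. AE x in lebesgue_on {0..len e}. f e x = g e x)"

definition L2_inner ::
  "('v, 'e) pre_digraph \<Rightarrow> ('e \<Rightarrow> real) \<Rightarrow> 'e graph_fun \<Rightarrow> 'e graph_fun \<Rightarrow> real" where
  "L2_inner G len f g = (\<Sum>e\<in>arcs G. LINT x|lebesgue_on {0..len e}. f e x * g e x)"

definition L2_norm :: "('v, 'e) pre_digraph \<Rightarrow> ('e \<Rightarrow> real) \<Rightarrow> 'e graph_fun \<Rightarrow> real" where
  "L2_norm G len f = sqrt (L2_inner G len f f)"

definition L2_tendsto ::
  "('v, 'e) pre_digraph \<Rightarrow> ('e \<Rightarrow> real) \<Rightarrow> (nat \<Rightarrow> 'e graph_fun) \<Rightarrow> 'e graph_fun \<Rightarrow> bool" where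
  "L2_tendsto G len S f \<longleftrightarrow>
     f \<in> L2 G len \<and> (\<lambda>n. L2_norm G len (\<lambda>e x. S n e x - f e x)) \<longlonglongrightarrow> 0"

text \<open>The limit is determined up to \<open>L2_eq\<close>; some representative is chosen.\<close>

definition L2_lim ::
  "('v, 'e) pre_digraph \<Rightarrow> ('e \<Rightarrow> real) \<Rightarrow> (nat \<Rightarrow> 'e graph_fun) \<Rightarrow> 'e graph_fun" where
  "L2_lim G len S = (SOME f. L2_tendsto G len S f)"


section \<open>The Kirchhoff Laplacian\<close>

text \<open>
  \<open>f\<close> is the (absolutely) continuous representative of an element of the Sobolev space of
  order one on \<open>{0..l}\<close>, and \<open>g\<close> is a square integrable representative of its derivative.
\<close>

definition sobolev_deriv :: "real \<Rightarrow> (real \<Rightarrow> real) \<Rightarrow> (real \<Rightarrow> real) \<Rightarrow> bool" where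
  "sobolev_deriv l f g \<longleftrightarrow>
     square_integrable l g \<and> (\<forall>x\<in>{0..l}. f x = f 0 + (LINT t|lebesgue_on {0..x}. g t))"

definition continuous_on_graph ::
  "('v, 'e) pre_digraph \<Rightarrow> ('e \<Rightarrow> real) \<Rightarrow> 'e graph_fun \<Rightarrow> bool" where
  "continuous_on_graph G len f \<longleftrightarrow>
     (\<forall>e\<in>arcs G. continuous_on {0..len e} (f e)) \<and>
     (\<exists>val. \<forall>e\<in>arcs G. f e 0 = val (tail G e) \<and> f e (len e) = val (head G e))"

text \<open>
  The derivative in the direction away from the vertex is \<open>f' e 0\<close> at the tail and
  \<open>- f' e (len e)\<close> at the head of \<open>e\<close>; a loop occurs in both sums.
\<close>

definition kirchhoff_condition ::
  "('v, 'e) pre_digraph \<Rightarrow> ('e \<Rightarrow> real) \<Rightarrow> 'e graph_fun \<Rightarrow> bool" where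
  "kirchhoff_condition G len f' \<longleftrightarrow>
     (\<forall>v\<in>verts G. (\<Sum>e\<in>out_arcs G v. f' e 0) + (\<Sum>e\<in>in_arcs G v. - f' e (len e)) = 0)"

text \<open>
  The unbounded operator is given by its graph: \<open>f\<close> is in the domain and \<open>h\<close> represents its
  image. The first derivative \<open>f'\<close> below is the continuous one, since it is itself a primitive,
  so its values at the end points are meaningful.
\<close>

definition kirchhoff_laplacian ::
  "('v, 'e) pre_digraph \<Rightarrow> ('e \<Rightarrow> real) \<Rightarrow> 'e graph_fun \<Rightarrow> 'e graph_fun \<Rightarrow> bool" where
  "kirchhoff_laplacian G len f h \<longleftrightarrow>
     continuous_on_graph G len f \<and>
     (\<exists>f'. (\<forall>e\<in>arcs G. sobolev_deriv (len e) (f e) (f' e) \<and> sobolev_deriv (len e) (f' e) (h e)) \<and>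
           kirchhoff_condition G len f')"

text \<open>The operator \<open>L = \<kappa>\<^sup>2 - \<Delta>\<close>, again given by its graph.\<close>

definition L_operator ::
  "('v, 'e) pre_digraph \<Rightarrow> ('e \<Rightarrow> real) \<Rightarrow> real \<Rightarrow> 'e graph_fun \<Rightarrow> 'e graph_fun \<Rightarrow> bool" where
  "L_operator G len \<kappa> f g \<longleftrightarrow>
     (\<exists>h. kirchhoff_laplacian G len f h \<and> L2_eq G len g (\<lambda>e x. \<kappa>\<^sup>2 * f e x - h e x))"

definition eigenbasis ::
  "('v, 'e) pre_digraph \<Rightarrow> ('e \<Rightarrow> real) \<Rightarrow> real \<Rightarrow> (nat \<Rightarrow> 'e graph_fun) \<Rightarrow> (nat \<Rightarrow> real) \<Rightarrow> bool"
where
  "eigenbasis G len \<kappa> \<phi> lam \<longleftrightarrow>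
     (\<forall>i. L_operator G len \<kappa> (\<phi> i) (\<lambda>e x. lam i * \<phi> i e x)) \<and>
     0 < lam 0 \<and> mono lam \<and>
     (\<forall>i j. L2_inner G len (\<phi> i) (\<phi> j) = (if i = j then 1 else 0)) \<and>
     (\<forall>f\<in>L2 G len. L2_tendsto G len (\<lambda>n e x. \<Sum>i<n. L2_inner G len f (\<phi> i) * \<phi> i e x) f)"


section \<open>Fractional powers and the associated scale of spaces\<close>

definition Hdot ::
  "('v, 'e) pre_digraph \<Rightarrow> ('e \<Rightarrow> real) \<Rightarrow> (nat \<Rightarrow> 'e graph_fun) \<Rightarrow> (nat \<Rightarrow> real) \<Rightarrow> real \<Rightarrow>
     'e graph_fun set" where
  "Hdot G len \<phi> lam \<alpha> =
     {\<psi> \<in> L2 G len. summable (\<lambda>i. lam i powr \<alpha> * (L2_inner G len \<psi> (\<phi> i))\<^sup>2)}"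

definition Hdot_norm ::
  "('v, 'e) pre_digraph \<Rightarrow> ('e \<Rightarrow> real) \<Rightarrow> (nat \<Rightarrow> 'e graph_fun) \<Rightarrow> (nat \<Rightarrow> real) \<Rightarrow> real \<Rightarrow>
     'e graph_fun \<Rightarrow> real" where
  "Hdot_norm G len \<phi> lam \<alpha> \<psi> = sqrt (\<Sum>i. lam i powr \<alpha> * (L2_inner G len \<psi> (\<phi> i))\<^sup>2)"

text \<open>\<open>L_power G len \<phi> lam \<beta>\<close> is \<open>L\<close> to the power \<open>\<beta>\<close>, with domain \<open>Hdot G len \<phi> lam (2 * \<beta>)\<close>.\<close>

definition L_power ::
  "('v, 'e) pre_digraph \<Rightarrow> ('e \<Rightarrow> real) \<Rightarrow> (nat \<Rightarrow> 'e graph_fun) \<Rightarrow> (nat \<Rightarrow> real) \<Rightarrow> real \<Rightarrow>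
     'e graph_fun \<Rightarrow> 'e graph_fun" where
  "L_power G len \<phi> lam \<beta> \<psi> =
     L2_lim G len (\<lambda>n e x. \<Sum>i<n. lam i powr \<beta> * L2_inner G len \<psi> (\<phi> i) * \<phi> i e x)"

text \<open>
  The dual of \<open>Hdot G len \<phi> lam \<alpha>\<close>. Only the values of a functional on that space matter, so
  equality in the dual is \<open>Hdot_dual_eq\<close>. Boundedness makes a functional respect \<open>L2_eq\<close>.
\<close>

type_synonym 'e graph_functional = "'e graph_fun \<Rightarrow> real"

definition Hdot_dual ::
  "('v, 'e) pre_digraph \<Rightarrow> ('e \<Rightarrow> real) \<Rightarrow> (nat \<Rightarrow> 'e graph_fun) \<Rightarrow> (nat \<Rightarrow> real) \<Rightarrow> real \<Rightarrow>
     'e graph_functional set" where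
  "Hdot_dual G len \<phi> lam \<alpha> =
     {F. (\<forall>\<psi>\<in>Hdot G len \<phi> lam \<alpha>. \<forall>\<eta>\<in>Hdot G len \<phi> lam \<alpha>. F (\<lambda>e x. \<psi> e x + \<eta> e x) = F \<psi> + F \<eta>) \<and>
         (\<forall>c. \<forall>\<psi>\<in>Hdot G len \<phi> lam \<alpha>. F (\<lambda>e x. c * \<psi> e x) = c * F \<psi>) \<and>
         (\<exists>C. \<forall>\<psi>\<in>Hdot G len \<phi> lam \<alpha>. \<bar>F \<psi>\<bar> \<le> C * Hdot_norm G len \<phi> lam \<alpha> \<psi>)}"

definition Hdot_dual_eq ::
  "('v, 'e) pre_digraph \<Rightarrow> ('e \<Rightarrow> real) \<Rightarrow> (nat \<Rightarrow> 'e graph_fun) \<Rightarrow> (nat \<Rightarrow> real) \<Rightarrow> real \<Rightarrow>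
     'e graph_functional \<Rightarrow> 'e graph_functional \<Rightarrow> bool" where
  "Hdot_dual_eq G len \<phi> lam \<alpha> F F' \<longleftrightarrow>
     F \<in> Hdot_dual G len \<phi> lam \<alpha> \<and> F' \<in> Hdot_dual G len \<phi> lam \<alpha> \<and>
     (\<forall>\<psi>\<in>Hdot G len \<phi> lam \<alpha>. F \<psi> = F' \<psi>)"

definition Hdot_dual_norm ::
  "(nat \<Rightarrow> 'e graph_fun) \<Rightarrow> (nat \<Rightarrow> real) \<Rightarrow> real \<Rightarrow> 'e graph_functional \<Rightarrow> real" where
  "Hdot_dual_norm \<phi> lam \<alpha> F = sqrt (\<Sum>i. lam i powr (- \<alpha>) * (F (\<phi> i))\<^sup>2)"

text \<open>
  The extension by duality of \<open>L_power G len \<phi> lam \<beta>\<close> to all of \<open>L2 G len\<close>, with values in the dual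
  of \<open>Hdot G len \<phi> lam (2 * \<beta>)\<close>.
\<close>

definition L_power_ext ::
  "('v, 'e) pre_digraph \<Rightarrow> ('e \<Rightarrow> real) \<Rightarrow> (nat \<Rightarrow> 'e graph_fun) \<Rightarrow> (nat \<Rightarrow> real) \<Rightarrow> real \<Rightarrow>
     'e graph_fun \<Rightarrow> 'e graph_functional" where
  "L_power_ext G len \<phi> lam \<beta> u = (\<lambda>\<psi>. L2_inner G len u (L_power G len \<phi> lam \<beta> \<psi>))"


section \<open>Gaussian white noise\<close>

text \<open>The partial sums of \<open>\<Sum>i. \<xi> i \<phi> i\<close>, as functionals via the inner product.\<close>

definition noise_partial_sum ::
  "('v, 'e) pre_digraph \<Rightarrow> ('e \<Rightarrow> real) \<Rightarrow> (nat \<Rightarrow> 'e graph_fun) \<Rightarrow> (nat \<Rightarrow> 'w \<Rightarrow> real) \<Rightarrow> nat \<Rightarrow>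
     'w \<Rightarrow> 'e graph_functional" where
  "noise_partial_sum G len \<phi> \<xi> n \<omega> = (\<lambda>\<psi>. \<Sum>i<n. \<xi> i \<omega> * L2_inner G len (\<phi> i) \<psi>)"

text \<open>
  \<open>W\<close> is an (almost surely defined) random element of the dual of \<open>Hdot G len \<phi> lam s\<close> to which the
  partial sums converge in mean square.
\<close>

definition noise_tendsto ::
  "('v, 'e) pre_digraph \<Rightarrow> ('e \<Rightarrow> real) \<Rightarrow> (nat \<Rightarrow> 'e graph_fun) \<Rightarrow> (nat \<Rightarrow> real) \<Rightarrow> 'w measure \<Rightarrow>
     (nat \<Rightarrow> 'w \<Rightarrow> real) \<Rightarrow> real \<Rightarrow> ('w \<Rightarrow> 'e graph_functional) \<Rightarrow> bool" where
  "noise_tendsto G len \<phi> lam M \<xi> s W \<longleftrightarrow>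
     (AE \<omega> in M. W \<omega> \<in> Hdot_dual G len \<phi> lam s) \<and>
     (\<forall>\<psi>\<in>Hdot G len \<phi> lam s. (\<lambda>\<omega>. W \<omega> \<psi>) \<in> borel_measurable M) \<and>
     (\<lambda>n. \<integral>\<^sup>+ \<omega>. ennreal ((Hdot_dual_norm \<phi> lam s
              (\<lambda>\<psi>. noise_partial_sum G len \<phi> \<xi> n \<omega> \<psi> - W \<omega> \<psi>))\<^sup>2) \<partial>M) \<longlonglongrightarrow> 0"

text \<open>
  The sum \<open>\<Sum>i. \<xi> i \<phi> i\<close>, i.e. the mean square limit of the partial sums in the dual of
  \<open>Hdot G len \<phi> lam s\<close> for every \<open>s > 1/2\<close>. As for \<^const>\<open>suminf\<close>, convergence is not part
  of the definition but has to be proved; the limit is unique up to null sets.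
\<close>

definition white_noise ::
  "('v, 'e) pre_digraph \<Rightarrow> ('e \<Rightarrow> real) \<Rightarrow> (nat \<Rightarrow> 'e graph_fun) \<Rightarrow> (nat \<Rightarrow> real) \<Rightarrow> 'w measure \<Rightarrow>
     (nat \<Rightarrow> 'w \<Rightarrow> real) \<Rightarrow> 'w \<Rightarrow> 'e graph_functional" where
  "white_noise G len \<phi> lam M \<xi> = (SOME W. \<forall>s>1/2. noise_tendsto G len \<phi> lam M \<xi> s W)"

end

theory Submission
  imports Defs
begin

text \<open>
  The theorem splits into a deterministic and a probabilistic half.

  Deterministically, \<open>L\<close> to the power \<open>\<alpha> / 2\<close> maps \<open>L2\<close> bijectively onto the dual of \<open>Hdot \<alpha>\<close>, for
  every real \<open>\<alpha>\<close>. In the eigenbasis it multiplies the \<open>i\<close>-th coefficient by \<open>lam i powr (\<alpha> / 2)\<close>, while a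
  bounded functional \<open>F\<close> on \<open>Hdot \<alpha>\<close> is determined by the numbers \<open>F (\<phi> i)\<close>
  (\<open>Hdot_dual_expansion\<close>), which satisfy \<open>\<Sum>i. lam i powr (-\<alpha>) * (F (\<phi> i))\<^sup>2 < \<infinity>\<close>
  (\<open>Hdot_dual_summable\<close>). So the coefficients of a solution are forced, which gives uniqueness, and they
  are square summable, so that completeness of \<open>L2\<close> (\<open>Riesz_Fischer\<close>) provides a solution. This is
  \<open>fractional_equation_unique_solution\<close>, and it remains to see that almost every realisation of the
  noise belongs to the dual of \<open>Hdot \<alpha>\<close>.

  The noise has the random coefficients \<open>\<xi> i\<close>, and the expectation of \<open>\<Sum>i. lam i powr (-s) * (\<xi> i)\<^sup>2\<close> is
  \<open>\<Sum>i. lam i powr (-s)\<close>. So what matters is that this series converges for every \<open>s > 1/2\<close>, which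
  follows from eigenvalue growth of order \<open>n\<^sup>2\<close> (\<open>Weyl_lower_bound\<close>). Rather than by the min-max
  principle, growth is obtained from the kernel \<open>K(x) = \<Sum>i\<le>n. (\<phi> i x)\<^sup>2\<close>. For fixed \<open>x\<close>, the
  function \<open>f = \<Sum>i\<le>n. \<phi> i x * \<phi> i\<close> satisfies \<open>f x = K(x)\<close> and \<open>\<parallel>f\<parallel>\<^sup>2 = K(x)\<close>, and
  integration by parts, where the vertex conditions cancel the boundary terms, gives
  \<open>\<parallel>f'\<parallel>\<^sup>2 \<le> lam n * K(x)\<close>. The one-dimensional Sobolev inequality, which bounds \<open>(f x)\<^sup>2\<close> by
  \<open>\<parallel>f\<parallel>\<^sup>2 / l + 2 \<parallel>f\<parallel> \<parallel>f'\<parallel>\<close> on an edge of length \<open>l\<close>, then turns into \<open>K(x) \<le> 1 / l + 2 sqrt (lam n)\<close>.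
  The integral of \<open>K\<close> over the graph is \<open>n + 1\<close>, so \<open>n + 1\<close> is at most the number of edges plus
  \<open>2 sqrt (lam n)\<close> times the total length.
\<close>


section \<open>Series of real numbers\<close>

lemma suminf_tail_tendsto_0:
  fixes a :: "nat \<Rightarrow> real"
  assumes "summable a"
  shows "(\<lambda>n. \<Sum>i. if i < n then 0 else a i) \<longlonglongrightarrow> 0"
proof -
  have "(\<lambda>i. if i < n then 0 else a i) sums (suminf a - sum a {..<n})" for n
  proof -
    have "(\<lambda>i. if i < n then a i else 0) sums (\<Sum>i | i < n. a i)"
      by (rule sums_If_finite) simp
    from sums_diff[OF summable_sums[OF assms] this]
    show ?thesis
      by (simp add: lessThan_def if_distrib[of "\<lambda>x. a _ - x"] cong: if_cong)
  qed
  then have "(\<lambda>n. \<Sum>i. if i < n then 0 else a i) = (\<lambda>n. suminf a - sum a {..<n})"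
    by (auto simp: sums_iff)
  moreover have "(\<lambda>n. suminf a - sum a {..<n}) \<longlonglongrightarrow> suminf a - suminf a"
    by (intro tendsto_intros summable_LIMSEQ assms)
  ultimately show ?thesis by simp
qed

lemma abs_mult_le_sum_squares: "\<bar>x * y\<bar> \<le> x\<^sup>2 + y\<^sup>2" for x y :: real
proof -
  have "2 * \<bar>x * y\<bar> \<le> x\<^sup>2 + y\<^sup>2"
    using sum_squares_bound[of "\<bar>x\<bar>" "\<bar>y\<bar>"] by (simp add: abs_mult)
  then show ?thesis
    using abs_ge_zero[of "x * y"] by linarith
qed

lemma summable_mult_of_squares:
  fixes a b :: "nat \<Rightarrow> real"
  assumes "summable (\<lambda>i. (a i)\<^sup>2)" "summable (\<lambda>i. (b i)\<^sup>2)"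
  shows "summable (\<lambda>i. a i * b i)"
proof (rule summable_comparison_test')
  show "summable (\<lambda>i. (a i)\<^sup>2 + (b i)\<^sup>2)" using assms by (rule summable_add)
  show "norm (a i * b i) \<le> (a i)\<^sup>2 + (b i)\<^sup>2" if "i \<ge> 0" for i
    using abs_mult_le_sum_squares[of "a i" "b i"] by simp
qed

lemma Cauchy_Schwarz_suminf:
  fixes a b :: "nat \<Rightarrow> real"
  assumes a: "summable (\<lambda>i. (a i)\<^sup>2)" and b: "summable (\<lambda>i. (b i)\<^sup>2)"
  shows "\<bar>\<Sum>i. a i * b i\<bar> \<le> sqrt (\<Sum>i. (a i)\<^sup>2) * sqrt (\<Sum>i. (b i)\<^sup>2)"
proof -
  have "(\<lambda>n. (\<Sum>i<n. a i * b i)\<^sup>2) \<longlonglongrightarrow> (\<Sum>i. a i * b i)\<^sup>2"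
    by (intro tendsto_intros summable_LIMSEQ summable_mult_of_squares a b)
  moreover have "(\<lambda>n. (\<Sum>i<n. (a i)\<^sup>2) * (\<Sum>i<n. (b i)\<^sup>2)) \<longlonglongrightarrow> (\<Sum>i. (a i)\<^sup>2) * (\<Sum>i. (b i)\<^sup>2)"
    by (intro tendsto_intros summable_LIMSEQ a b)
  ultimately have "(\<Sum>i. a i * b i)\<^sup>2 \<le> (\<Sum>i. (a i)\<^sup>2) * (\<Sum>i. (b i)\<^sup>2)"
    by (rule LIMSEQ_le) (auto intro: Cauchy_Schwarz_ineq_sum)
  then show ?thesis
    by (metis real_sqrt_abs real_sqrt_le_mono real_sqrt_mult)
qed


section \<open>Completeness of spaces of square integrable functions\<close>

lemma integrable_mult_of_squares:
  fixes f g :: "'a \<Rightarrow> real"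
  assumes [measurable]: "f \<in> borel_measurable M" "g \<in> borel_measurable M"
    and "integrable M (\<lambda>x. (f x)\<^sup>2)" "integrable M (\<lambda>x. (g x)\<^sup>2)"
  shows "integrable M (\<lambda>x. f x * g x)"
proof (rule Bochner_Integration.integrable_bound)
  show "integrable M (\<lambda>x. (f x)\<^sup>2 + (g x)\<^sup>2)" using assms by simp
  show "AE x in M. norm (f x * g x) \<le> norm ((f x)\<^sup>2 + (g x)\<^sup>2)"
  proof (rule AE_I2)
    fix x
    show "norm (f x * g x) \<le> norm ((f x)\<^sup>2 + (g x)\<^sup>2)"
      using abs_mult_le_sum_squares[of "f x" "g x"] by simp
  qed
qed measurable

lemma integrable_diff_square:
  fixes f g :: "'a \<Rightarrow> real"
  assumes [measurable]: "f \<in> borel_measurable M" "g \<in> borel_measurable M"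
    and "integrable M (\<lambda>x. (f x)\<^sup>2)" "integrable M (\<lambda>x. (g x)\<^sup>2)"
  shows "integrable M (\<lambda>x. (f x - g x)\<^sup>2)"
proof -
  have "integrable M (\<lambda>x. (f x)\<^sup>2 + (g x)\<^sup>2 - 2 * (f x * g x))"
    using assms integrable_mult_of_squares[OF assms] by simp
  then show ?thesis by (simp add: power2_diff mult.assoc)
qed

text \<open>
  Along a subsequence whose increments \<open>d k\<close> satisfy \<open>\<integral>(d k)\<^sup>2 \<le> (1/4)^k\<close>, the increments are absolutely
  summable almost everywhere: \<open>\<bar>d k\<bar> \<le> (1/2)^k + 2^k * (d k)\<^sup>2\<close>, and on a finite measure space both
  terms have integrals of order \<open>(1/2)^k\<close>. Fatou's lemma upgrades the pointwise limit to a limit in mean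
  square.
\<close>

lemma (in finite_measure) Riesz_Fischer:
  fixes S :: "nat \<Rightarrow> 'a \<Rightarrow> real"
  assumes S[measurable]: "\<And>n. S n \<in> borel_measurable M"
    and S2: "\<And>n. integrable M (\<lambda>x. (S n x)\<^sup>2)"
    and Cauchy: "\<And>\<epsilon>. \<epsilon> > 0 \<Longrightarrow> \<exists>N. \<forall>m\<ge>N. \<forall>n\<ge>N. (LINT x|M. (S m x - S n x)\<^sup>2) < \<epsilon>"
  shows "\<exists>f. f \<in> borel_measurable M \<and> integrable M (\<lambda>x. (f x)\<^sup>2) \<and>
             (\<lambda>n. LINT x|M. (S n x - f x)\<^sup>2) \<longlonglongrightarrow> 0"
proof -
  have D2: "integrable M (\<lambda>x. (S m x - S n x)\<^sup>2)" for m n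
    by (intro integrable_diff_square S S2)
  have "\<forall>k. \<exists>N. \<forall>m\<ge>N. \<forall>n\<ge>N. (LINT x|M. (S m x - S n x)\<^sup>2) < (1/4)^k"
    by (intro allI Cauchy) simp
  then obtain N where N: "\<And>k m n. m \<ge> N k \<Longrightarrow> n \<ge> N k \<Longrightarrow> (LINT x|M. (S m x - S n x)\<^sup>2) < (1/4)^k"
    by metis
  define r where "r k = (\<Sum>j\<le>k. N j) + k" for k
  have r_ge: "N k \<le> r k" for k
    unfolding r_def by (rule trans_le_add1) (rule member_le_sum, auto)
  have r_Suc: "r k \<le> r (Suc k)" for k
    by (simp add: r_def)
  have r_lim: "filterlim r at_top sequentially"
    by (rule filterlim_at_top_mono[OF filterlim_ident]) (simp add: r_def)
  define d where "d k x = S (r (Suc k)) x - S (r k) x" for k x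
  have d[measurable]: "d k \<in> borel_measurable M" for k
    unfolding d_def by measurable
  have d2_int: "integrable M (\<lambda>x. (d k x)\<^sup>2)" for k
    unfolding d_def by (rule D2)
  have d2: "(LINT x|M. (d k x)\<^sup>2) \<le> (1/4)^k" for k
    unfolding d_def by (rule less_imp_le, rule N) (use r_ge[of k] r_Suc[of k] in auto)
  have d1: "\<bar>d k x\<bar> \<le> (1/2)^k + 2^k * (d k x)\<^sup>2" for k x
  proof -
    have "2^k * \<bar>d k x\<bar> \<le> 2 * (2^k * \<bar>d k x\<bar>)"
      by simp
    also have "\<dots> \<le> 1 + (2^k * \<bar>d k x\<bar>)\<^sup>2"
      using sum_squares_bound[of 1 "2^k * \<bar>d k x\<bar>"] by simp
    also have "(2^k * \<bar>d k x\<bar>)\<^sup>2 = 2^k * (2^k * (d k x)\<^sup>2)"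
      unfolding power_mult_distrib power2_abs by (simp add: power2_eq_square)
    also have "1 + 2^k * (2^k * (d k x)\<^sup>2) = 2^k * ((1/2)^k + 2^k * (d k x)\<^sup>2)"
      by (simp add: algebra_simps power_one_over)
    finally show ?thesis by simp
  qed
  have nn: "(\<integral>\<^sup>+x. ennreal \<bar>d k x\<bar> \<partial>M) \<le> ennreal ((1/2)^k * (measure M (space M) + 1))" for k
  proof -
    have "(\<integral>\<^sup>+x. ennreal \<bar>d k x\<bar> \<partial>M) \<le> (\<integral>\<^sup>+x. ennreal ((1/2)^k + 2^k * (d k x)\<^sup>2) \<partial>M)"
      by (intro nn_integral_mono ennreal_leI d1)
    also have "\<dots> = ennreal (LINT x|M. (1/2)^k + 2^k * (d k x)\<^sup>2)"
      by (intro nn_integral_eq_integral Bochner_Integration.integrable_add integrable_mult_right d2_int) auto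
    also have "\<dots> \<le> ennreal ((1/2)^k * (measure M (space M) + 1))"
    proof (rule ennreal_leI)
      have "(LINT x|M. (1/2)^k + 2^k * (d k x)\<^sup>2) = (1/2)^k * measure M (space M) + 2^k * (LINT x|M. (d k x)\<^sup>2)"
        using d2_int[of k] by simp
      also have "2^k * (LINT x|M. (d k x)\<^sup>2) \<le> 2^k * (1/4)^k"
        by (intro mult_left_mono d2) simp
      also have "2^k * (1/4)^k = ((1/2)^k :: real)"
        by (simp flip: power_mult_distrib)
      finally show "(LINT x|M. (1/2)^k + 2^k * (d k x)\<^sup>2) \<le> (1/2)^k * (measure M (space M) + 1)"
        by (simp add: algebra_simps)
    qed
    finally show ?thesis .
  qed
  have sum_fin: "(\<Sum>k. ennreal ((1/2)^k * (measure M (space M) + 1))) \<noteq> \<infinity>"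
    by (subst suminf_ennreal2) (auto intro!: summable_mult2 summable_geometric)
  have "(\<integral>\<^sup>+x. (\<Sum>k. ennreal \<bar>d k x\<bar>) \<partial>M) = (\<Sum>k. \<integral>\<^sup>+x. ennreal \<bar>d k x\<bar> \<partial>M)"
    by (rule nn_integral_suminf) measurable
  also have "\<dots> \<le> (\<Sum>k. ennreal ((1/2)^k * (measure M (space M) + 1)))"
    by (intro suminf_le nn) auto
  finally have "(\<integral>\<^sup>+x. (\<Sum>k. ennreal \<bar>d k x\<bar>) \<partial>M) \<noteq> \<infinity>"
    using sum_fin by (auto simp: top_unique)
  then have "AE x in M. (\<Sum>k. ennreal \<bar>d k x\<bar>) \<noteq> \<infinity>"
    by (intro nn_integral_noteq_infinite) measurable
  then have conv: "AE x in M. convergent (\<lambda>k. S (r k) x)"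
  proof eventually_elim
    case (elim x)
    then have "summable (\<lambda>k. \<bar>d k x\<bar>)"
      by (intro summable_suminf_not_top) (auto simp: top_ennreal_def)
    then have "summable (\<lambda>k. d k x)"
      by (rule summable_rabs_cancel)
    then have "convergent (\<lambda>n. (\<Sum>k<n. d k x) + S (r 0) x)"
      by (intro convergent_add convergent_const) (simp add: summable_iff_convergent)
    moreover have "(\<Sum>k<n. d k x) + S (r 0) x = S (r n) x" for n
      unfolding d_def by (subst sum_lessThan_telescope) simp
    ultimately show ?case by simp
  qed
  define f where "f x = lim (\<lambda>k. S (r k) x)" for x
  have f[measurable]: "f \<in> borel_measurable M"
    unfolding f_def by measurable
  have bound: "(\<integral>\<^sup>+x. ennreal ((S m x - f x)\<^sup>2) \<partial>M) \<le> ennreal ((1/4)^j)" if "m \<ge> N j" for m j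
  proof -
    have "(\<integral>\<^sup>+x. ennreal ((S m x - f x)\<^sup>2) \<partial>M) = (\<integral>\<^sup>+x. liminf (\<lambda>k. ennreal ((S m x - S (r k) x)\<^sup>2)) \<partial>M)"
    proof (rule nn_integral_cong_AE)
      show "AE x in M. ennreal ((S m x - f x)\<^sup>2) = liminf (\<lambda>k. ennreal ((S m x - S (r k) x)\<^sup>2))"
        using conv
      proof eventually_elim
        case (elim x)
        then have "(\<lambda>k. S (r k) x) \<longlonglongrightarrow> f x"
          unfolding f_def by (simp add: convergent_LIMSEQ_iff)
        then have "(\<lambda>k. ennreal ((S m x - S (r k) x)\<^sup>2)) \<longlonglongrightarrow> ennreal ((S m x - f x)\<^sup>2)"
          by (intro tendsto_intros) auto
        then show ?case
          by (intro lim_imp_Liminf[symmetric]) auto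
      qed
    qed
    also have "\<dots> \<le> liminf (\<lambda>k. \<integral>\<^sup>+x. ennreal ((S m x - S (r k) x)\<^sup>2) \<partial>M)"
      by (rule nn_integral_liminf) measurable
    also have "\<dots> \<le> liminf (\<lambda>k. ennreal ((1/4)^j))"
    proof (rule Liminf_mono)
      have "eventually (\<lambda>k. r k \<ge> N j) sequentially"
        using r_lim by (simp add: filterlim_at_top)
      then show "\<forall>\<^sub>F k in sequentially. (\<integral>\<^sup>+x. ennreal ((S m x - S (r k) x)\<^sup>2) \<partial>M) \<le> ennreal ((1/4)^j)"
      proof eventually_elim
        case (elim k)
        have "(\<integral>\<^sup>+x. ennreal ((S m x - S (r k) x)\<^sup>2) \<partial>M) = ennreal (LINT x|M. (S m x - S (r k) x)\<^sup>2)"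
          by (intro nn_integral_eq_integral D2) auto
        also have "\<dots> \<le> ennreal ((1/4)^j)"
          by (rule ennreal_leI, rule less_imp_le, rule N) (use that elim in auto)
        finally show ?case .
      qed
    qed
    finally show ?thesis by (simp add: Liminf_const)
  qed
  have int: "integrable M (\<lambda>x. (S m x - f x)\<^sup>2)" if "m \<ge> N 0" for m
  proof (rule integrableI_bounded)
    show "(\<integral>\<^sup>+x. ennreal (norm ((S m x - f x)\<^sup>2)) \<partial>M) < \<infinity>"
      using le_less_trans[OF bound[OF that] ennreal_less_top] by simp
  qed measurable
  have "integrable M (\<lambda>x. (S (N 0) x - (S (N 0) x - f x))\<^sup>2)"
    by (rule integrable_diff_square[OF _ _ S2 int]) simp_all
  then have f2: "integrable M (\<lambda>x. (f x)\<^sup>2)" by simp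
  have "(\<lambda>n. LINT x|M. (S n x - f x)\<^sup>2) \<longlonglongrightarrow> 0"
  proof (rule LIMSEQ_I)
    fix \<epsilon> :: real assume "\<epsilon> > 0"
    then obtain j where j: "(1/4)^j < \<epsilon>"
      using real_arch_pow_inv[of \<epsilon> "1/4"] by auto
    have "norm ((LINT x|M. (S n x - f x)\<^sup>2) - 0) < \<epsilon>" if "n \<ge> N j" for n
    proof -
      have "ennreal (LINT x|M. (S n x - f x)\<^sup>2) = (\<integral>\<^sup>+x. ennreal ((S n x - f x)\<^sup>2) \<partial>M)"
        by (intro nn_integral_eq_integral[symmetric] integrable_diff_square S2 f2) auto
      also have "\<dots> \<le> ennreal ((1/4)^j)" by (rule bound[OF that])
      finally have "(LINT x|M. (S n x - f x)\<^sup>2) \<le> (1/4)^j"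
        by simp
      with j show ?thesis by (simp add: abs_of_nonneg)
    qed
    then show "\<exists>no. \<forall>n\<ge>no. norm ((LINT x|M. (S n x - f x)\<^sup>2) - 0) < \<epsilon>"
      by blast
  qed
  with f f2 show ?thesis by blast
qed


section \<open>The space of square integrable functions on the graph\<close>

lemma square_integrable_diff:
  assumes "square_integrable l f" "square_integrable l g"
  shows "square_integrable l (\<lambda>x. f x - g x)"
  using assms unfolding square_integrable_def by (auto intro: integrable_diff_square)

lemma square_integrable_scale:
  assumes "square_integrable l f"
  shows "square_integrable l (\<lambda>x. c * f x)"
  using assms unfolding square_integrable_def by (auto simp: power_mult_distrib)

lemma square_integrable_add:
  assumes "square_integrable l f" "square_integrable l g"
  shows "square_integrable l (\<lambda>x. f x + g x)"
  using square_integrable_diff[OF assms(1) square_integrable_scale[OF assms(2), of "-1"]] by simp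

lemma square_integrable_mult:
  assumes "square_integrable l f" "square_integrable l g"
  shows "integrable (lebesgue_on {0..l}) (\<lambda>x. f x * g x)"
  using assms unfolding square_integrable_def by (auto intro: integrable_mult_of_squares)

lemma L2_add: "f \<in> L2 G len \<Longrightarrow> g \<in> L2 G len \<Longrightarrow> (\<lambda>e x. f e x + g e x) \<in> L2 G len"
  by (simp add: L2_def square_integrable_add)

lemma L2_diff: "f \<in> L2 G len \<Longrightarrow> g \<in> L2 G len \<Longrightarrow> (\<lambda>e x. f e x - g e x) \<in> L2 G len"
  by (simp add: L2_def square_integrable_diff)

lemma L2_scale: "f \<in> L2 G len \<Longrightarrow> (\<lambda>e x. c * f e x) \<in> L2 G len"
  by (simp add: L2_def square_integrable_scale)

lemma L2_zero: "(\<lambda>e x. 0) \<in> L2 G len"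
  by (simp add: L2_def square_integrable_def)

lemma L2_sum:
  "finite I \<Longrightarrow> (\<And>i. i \<in> I \<Longrightarrow> f i \<in> L2 G len) \<Longrightarrow> (\<lambda>e x. \<Sum>i\<in>I. f i e x) \<in> L2 G len"
  by (induction I rule: finite_induct) (simp_all add: L2_zero L2_add)

lemma L2_inner_commute: "L2_inner G len f g = L2_inner G len g f"
  by (simp add: L2_inner_def mult.commute)

lemma L2_inner_add_left:
  assumes "f \<in> L2 G len" "g \<in> L2 G len" "h \<in> L2 G len"
  shows "L2_inner G len (\<lambda>e x. f e x + g e x) h = L2_inner G len f h + L2_inner G len g h"
  using assms unfolding L2_inner_def L2_def sum.distrib[symmetric]
  by (intro sum.cong) (simp_all add: distrib_right square_integrable_mult)

lemma L2_inner_scale_left: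
  "L2_inner G len (\<lambda>e x. c * f e x) h = c * L2_inner G len f h"
  by (simp add: L2_inner_def sum_distrib_left mult.assoc)

lemma L2_inner_scale_right:
  "L2_inner G len h (\<lambda>e x. c * f e x) = c * L2_inner G len h f"
  using L2_inner_scale_left by (metis L2_inner_commute)

lemma L2_inner_diff_left:
  assumes "f \<in> L2 G len" "g \<in> L2 G len" "h \<in> L2 G len"
  shows "L2_inner G len (\<lambda>e x. f e x - g e x) h = L2_inner G len f h - L2_inner G len g h"
  using assms unfolding L2_inner_def L2_def sum_subtractf[symmetric]
  by (intro sum.cong) (simp_all add: left_diff_distrib square_integrable_mult)

lemma L2_inner_diff_right:
  assumes "f \<in> L2 G len" "g \<in> L2 G len" "h \<in> L2 G len"
  shows "L2_inner G len h (\<lambda>e x. f e x - g e x) = L2_inner G len h f - L2_inner G len h g"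
  using L2_inner_diff_left[OF assms] by (simp add: L2_inner_commute)

lemma L2_inner_zero_left: "L2_inner G len (\<lambda>e x. 0) h = 0"
  by (simp add: L2_inner_def)

lemma L2_inner_sum_left:
  assumes "finite I" "\<And>i. i \<in> I \<Longrightarrow> f i \<in> L2 G len" "h \<in> L2 G len"
  shows "L2_inner G len (\<lambda>e x. \<Sum>i\<in>I. f i e x) h = (\<Sum>i\<in>I. L2_inner G len (f i) h)"
  using assms
  by (induction I rule: finite_induct) (simp_all add: L2_inner_zero_left L2_inner_add_left L2_sum)

lemma L2_inner_sum_right:
  assumes "finite I" "\<And>i. i \<in> I \<Longrightarrow> f i \<in> L2 G len" "h \<in> L2 G len"
  shows "L2_inner G len h (\<lambda>e x. \<Sum>i\<in>I. f i e x) = (\<Sum>i\<in>I. L2_inner G len h (f i))"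
  using L2_inner_sum_left[OF assms] by (simp add: L2_inner_commute)

lemma L2_inner_self_nonneg: "0 \<le> L2_inner G len f f"
  by (auto simp: L2_inner_def intro!: sum_nonneg)

lemma L2_Cauchy_Schwarz:
  assumes f: "f \<in> L2 G len" and g: "g \<in> L2 G len"
  shows "\<bar>L2_inner G len f g\<bar> \<le> L2_norm G len f * L2_norm G len g"
proof -
  let ?I = "L2_inner G len"
  have quad: "0 \<le> ?I f f - 2 * t * ?I f g + t\<^sup>2 * ?I g g" for t
  proof -
    have tg: "(\<lambda>e x. t * g e x) \<in> L2 G len" using g by (rule L2_scale)
    have "0 \<le> ?I (\<lambda>e x. f e x - t * g e x) (\<lambda>e x. f e x - t * g e x)"
      by (rule L2_inner_self_nonneg)
    also have "\<dots> = ?I f f - 2 * t * ?I f g + t\<^sup>2 * ?I g g"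
      using f g tg L2_diff[OF f tg]
      by (simp add: L2_inner_diff_left L2_inner_diff_right L2_inner_scale_left L2_inner_scale_right
          L2_inner_commute[of G len g f] power2_eq_square algebra_simps)
    finally show ?thesis .
  qed
  have "(?I f g)\<^sup>2 \<le> ?I f f * ?I g g"
  proof (cases "?I g g = 0")
    case True
    have "?I f g = 0"
    proof (rule ccontr)
      assume "?I f g \<noteq> 0"
      then show False
        using quad[of "(?I f f + 1) / (2 * ?I f g)"] True by (simp add: field_simps)
    qed
    then show ?thesis using True by simp
  next
    case False
    then have "?I g g > 0" using L2_inner_self_nonneg[of G len g] by simp
    then show ?thesis
      using quad[of "?I f g / ?I g g"] by (simp add: field_simps power2_eq_square)
  qed
  then show ?thesis
    unfolding L2_norm_def by (metis real_sqrt_abs real_sqrt_le_mono real_sqrt_mult)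
qed

lemma L2_tendsto_inner:
  assumes lim: "L2_tendsto G len S f" and S: "\<And>n. S n \<in> L2 G len" and g: "g \<in> L2 G len"
  shows "(\<lambda>n. L2_inner G len (S n) g) \<longlonglongrightarrow> L2_inner G len f g"
proof (rule LIM_zero_cancel, rule Lim_null_comparison)
  have f: "f \<in> L2 G len" using lim by (simp add: L2_tendsto_def)
  have "norm (L2_inner G len (S n) g - L2_inner G len f g)
      \<le> L2_norm G len (\<lambda>e x. S n e x - f e x) * L2_norm G len g" for n
    using L2_Cauchy_Schwarz[OF L2_diff[OF S[of n] f] g] by (simp add: L2_inner_diff_left S f g)
  then show "\<forall>\<^sub>F n in sequentially. norm (L2_inner G len (S n) g - L2_inner G len f g)
      \<le> L2_norm G len (\<lambda>e x. S n e x - f e x) * L2_norm G len g"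
    by simp
  show "(\<lambda>n. L2_norm G len (\<lambda>e x. S n e x - f e x) * L2_norm G len g) \<longlonglongrightarrow> 0"
    using lim by (intro tendsto_mult_left_zero) (simp add: L2_tendsto_def)
qed

context compact_metric_graph
begin

lemma edge_integral_le_L2_inner:
  assumes "e \<in> arcs G"
  shows "(LINT x|lebesgue_on {0..len e}. (f e x)\<^sup>2) \<le> L2_inner G len f f"
  using assms unfolding L2_inner_def power2_eq_square
  by (intro member_le_sum) auto

lemma L2_eq_of_inner_0:
  assumes f: "f \<in> L2 G len" and g: "g \<in> L2 G len"
    and 0: "L2_inner G len (\<lambda>e x. f e x - g e x) (\<lambda>e x. f e x - g e x) = 0"
  shows "L2_eq G len f g"
  unfolding L2_eq_def
proof
  fix e assume e: "e \<in> arcs G"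
  have "(LINT x|lebesgue_on {0..len e}. (f e x - g e x)\<^sup>2) \<le> 0"
    using edge_integral_le_L2_inner[OF e, of "\<lambda>e x. f e x - g e x"] 0 by simp
  then have "(LINT x|lebesgue_on {0..len e}. (f e x - g e x)\<^sup>2) = 0"
    by (simp add: order_antisym)
  moreover have "integrable (lebesgue_on {0..len e}) (\<lambda>x. (f e x - g e x)\<^sup>2)"
    using square_integrable_diff[of "len e" "f e" "g e"] f g e
    by (simp add: L2_def square_integrable_def)
  ultimately have "AE x in lebesgue_on {0..len e}. (f e x - g e x)\<^sup>2 = 0"
    by (subst (asm) integral_nonneg_eq_0_iff_AE) auto
  then show "AE x in lebesgue_on {0..len e}. f e x = g e x"
    by simp
qed

text \<open>
  Restricting to an edge decreases the norm, so a Cauchy sequence on the graph is one on each edge, and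
  the edgewise limits can be glued because there are finitely many edges.
\<close>

lemma L2_complete:
  assumes S: "\<And>n. S n \<in> L2 G len"
    and Cauchy: "\<And>\<epsilon>. \<epsilon> > 0 \<Longrightarrow> \<exists>N. \<forall>m\<ge>N. \<forall>n\<ge>N.
      L2_inner G len (\<lambda>e x. S m e x - S n e x) (\<lambda>e x. S m e x - S n e x) < \<epsilon>"
  shows "\<exists>f. L2_tendsto G len S f"
proof -
  have "\<forall>e\<in>arcs G. \<exists>f. square_integrable (len e) f \<and>
      (\<lambda>n. LINT x|lebesgue_on {0..len e}. (S n e x - f x)\<^sup>2) \<longlonglongrightarrow> 0"
  proof
    fix e assume e: "e \<in> arcs G"
    interpret finite_measure "lebesgue_on {0..len e}"
      by (intro finite_measureI) (simp add: emeasure_restrict_space emeasure_lborel_Icc_eq)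
    have sq: "S n e \<in> borel_measurable (lebesgue_on {0..len e})"
      "integrable (lebesgue_on {0..len e}) (\<lambda>x. (S n e x)\<^sup>2)" for n
      using S[of n] e by (auto simp: L2_def square_integrable_def)
    have "\<exists>N. \<forall>m\<ge>N. \<forall>n\<ge>N. (LINT x|lebesgue_on {0..len e}. (S m e x - S n e x)\<^sup>2) < \<epsilon>"
      if \<epsilon>: "\<epsilon> > 0" for \<epsilon>
    proof -
      obtain N where "\<forall>m\<ge>N. \<forall>n\<ge>N.
        L2_inner G len (\<lambda>e x. S m e x - S n e x) (\<lambda>e x. S m e x - S n e x) < \<epsilon>"
        using Cauchy[OF \<epsilon>] by blast
      then show ?thesis
        using edge_integral_le_L2_inner[OF e] by (meson order.strict_trans1)
    qed
    from Riesz_Fischer[OF sq this]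
    show "\<exists>f. square_integrable (len e) f \<and>
        (\<lambda>n. LINT x|lebesgue_on {0..len e}. (S n e x - f x)\<^sup>2) \<longlonglongrightarrow> 0"
      by (auto simp: square_integrable_def)
  qed
  from bchoice[OF this] obtain f where
    f: "\<And>e. e \<in> arcs G \<Longrightarrow> square_integrable (len e) (f e)" and
    lim: "\<And>e. e \<in> arcs G \<Longrightarrow> (\<lambda>n. LINT x|lebesgue_on {0..len e}. (S n e x - f e x)\<^sup>2) \<longlonglongrightarrow> 0"
    by blast
  have "(\<lambda>n. \<Sum>e\<in>arcs G. LINT x|lebesgue_on {0..len e}. (S n e x - f e x)\<^sup>2) \<longlonglongrightarrow> 0"
    using lim by (rule tendsto_null_sum)
  then have "(\<lambda>n. sqrt (\<Sum>e\<in>arcs G. LINT x|lebesgue_on {0..len e}. (S n e x - f e x)\<^sup>2)) \<longlonglongrightarrow> sqrt 0"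
    by (rule tendsto_real_sqrt)
  then have "L2_tendsto G len S f"
    using f by (simp add: L2_tendsto_def L2_def L2_norm_def L2_inner_def power2_eq_square)
  then show ?thesis by (rule exI[of "L2_tendsto G len S"])
qed

end


section \<open>Expansions in the eigenbasis\<close>

locale graph_eigenbasis = compact_metric_graph G len
  for G :: "('v, 'e) pre_digraph" and len :: "'e \<Rightarrow> real" +
  fixes \<kappa> :: real and \<phi> :: "nat \<Rightarrow> 'e graph_fun" and lam :: "nat \<Rightarrow> real"
  assumes basis: "eigenbasis G len \<kappa> \<phi> lam"
begin

abbreviation coef :: "'e graph_fun \<Rightarrow> nat \<Rightarrow> real" where
  "coef f i \<equiv> L2_inner G len f (\<phi> i)"

abbreviation combination :: "nat set \<Rightarrow> (nat \<Rightarrow> real) \<Rightarrow> 'e graph_fun" where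
  "combination I c \<equiv> (\<lambda>e x. \<Sum>i\<in>I. c i * \<phi> i e x)"

lemma lam_mono: "i \<le> j \<Longrightarrow> lam i \<le> lam j"
  using basis by (auto simp: eigenbasis_def dest: monoD)

lemma lam_pos [simp]: "0 < lam i"
  using basis lam_mono[of 0 i] by (auto simp: eigenbasis_def)

lemma lam_powr_pos [simp]: "0 < lam i powr s"
  using lam_pos[of i] by (simp del: lam_pos)

lemma orthonormal: "L2_inner G len (\<phi> i) (\<phi> j) = (if i = j then 1 else 0)"
  using basis by (auto simp: eigenbasis_def)

lemma basis_expansion:
  "f \<in> L2 G len \<Longrightarrow> L2_tendsto G len (\<lambda>n. combination {..<n} (coef f)) f"
  using basis by (auto simp: eigenbasis_def)

text \<open>
  Eigenfunctions lie in the domain of \<open>L\<close>, so they are continuous on the compact edges.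
\<close>

lemma basis_in_L2 [simp]: "\<phi> i \<in> L2 G len"
proof -
  have cont: "continuous_on {0..len e} (\<phi> i e)" if "e \<in> arcs G" for e
    using basis that
    unfolding eigenbasis_def L_operator_def kirchhoff_laplacian_def continuous_on_graph_def by blast
  have "square_integrable (len e) (\<phi> i e)" if "e \<in> arcs G" for e
    unfolding square_integrable_def
    using cont[OF that]
    by (auto intro!: continuous_imp_integrable_real continuous_intros
        continuous_imp_measurable_on_sets_lebesgue)
  then show ?thesis by (simp add: L2_def)
qed

lemma combination_in_L2 [simp]: "finite I \<Longrightarrow> combination I c \<in> L2 G len"
  by (intro L2_sum L2_scale) auto

lemma coef_combination:
  "finite I \<Longrightarrow> coef (combination I c) j = (if j \<in> I then c j else 0)"
  by (simp add: L2_inner_sum_left L2_scale L2_inner_scale_left orthonormal if_distrib[of "(*) _"]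
      cong: if_cong)

lemma coef_scale: "coef (\<lambda>e x. a * f e x) i = a * coef f i"
  by (rule L2_inner_scale_left)

lemma coef_add:
  "f \<in> L2 G len \<Longrightarrow> g \<in> L2 G len \<Longrightarrow> coef (\<lambda>e x. f e x + g e x) i = coef f i + coef g i"
  by (simp add: L2_inner_add_left)

lemma coef_diff:
  "f \<in> L2 G len \<Longrightarrow> g \<in> L2 G len \<Longrightarrow> coef (\<lambda>e x. f e x - g e x) i = coef f i - coef g i"
  by (simp add: L2_inner_diff_left)

lemma inner_combination:
  assumes "finite I" "g \<in> L2 G len"
  shows "L2_inner G len (combination I c) g = (\<Sum>i\<in>I. c i * coef g i)"
  using assms by (simp add: L2_inner_sum_left L2_scale L2_inner_scale_left L2_inner_commute[of _ _ g])

text \<open>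
  Pairing the expansion of \<open>f\<close> with \<open>g\<close> is legitimate term by term because the inner product is
  continuous in its first argument.
\<close>

lemma Parseval:
  assumes "f \<in> L2 G len" "g \<in> L2 G len"
  shows "(\<lambda>i. coef f i * coef g i) sums L2_inner G len f g"
  using L2_tendsto_inner[OF basis_expansion[OF assms(1)] _ assms(2)] assms(2)
  by (simp add: sums_def inner_combination)

lemma summable_coef_squares: "f \<in> L2 G len \<Longrightarrow> summable (\<lambda>i. (coef f i)\<^sup>2)"
  using Parseval[of f f] by (auto simp: power2_eq_square sums_iff)

lemma L2_eq_of_coef:
  assumes f: "f \<in> L2 G len" and g: "g \<in> L2 G len" and eq: "\<And>i. coef f i = coef g i"
  shows "L2_eq G len f g"
proof (rule L2_eq_of_inner_0[OF f g])
  show "L2_inner G len (\<lambda>e x. f e x - g e x) (\<lambda>e x. f e x - g e x) = 0"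
    using Parseval[OF L2_diff[OF f g] L2_diff[OF f g]] by (simp add: coef_diff f g eq sums_iff)
qed

text \<open>
  By orthonormality the distance between two partial sums is a block of \<open>\<Sum>i. (c i)\<^sup>2\<close>.
\<close>

lemma square_summable_series_converges:
  assumes c: "summable (\<lambda>i. (c i)\<^sup>2)"
  shows "\<exists>f. L2_tendsto G len (\<lambda>n. combination {..<n} c) f"
proof (rule L2_complete)
  fix \<epsilon> :: real assume "\<epsilon> > 0"
  then obtain N where N: "\<And>m n. m \<ge> N \<Longrightarrow> norm (\<Sum>i\<in>{m..<n}. (c i)\<^sup>2) < \<epsilon>"
    using c unfolding summable_Cauchy by metis
  let ?d = "\<lambda>m n. (\<lambda>e x. combination {..<m} c e x - combination {..<n} c e x)"
  have norm_diff: "L2_inner G len (?d m n) (?d m n) < \<epsilon>" if "N \<le> m" "m \<le> n" for m n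
  proof -
    have d: "?d m n = combination {m..<n} (\<lambda>i. - c i)"
    proof (intro ext)
      fix e x
      have "(\<Sum>i<n. c i * \<phi> i e x) = (\<Sum>i<m. c i * \<phi> i e x) + (\<Sum>i\<in>{m..<n}. c i * \<phi> i e x)"
        using \<open>m \<le> n\<close> by (subst sum.union_disjoint[symmetric]) (auto intro: sum.cong)
      then show "?d m n e x = combination {m..<n} (\<lambda>i. - c i) e x"
        by (simp add: sum_negf)
    qed
    have "L2_inner G len (?d m n) (?d m n) = (\<Sum>i\<in>{m..<n}. (c i)\<^sup>2)"
      unfolding d
      by (simp only: inner_combination combination_in_L2 finite_atLeastLessThan coef_combination)
         (simp add: power2_eq_square)
    then show ?thesis using N[OF \<open>N \<le> m\<close>, of n] by simp
  qed
  have "L2_inner G len (?d m n) (?d m n) < \<epsilon>" if "m \<ge> N" "n \<ge> N" for m n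
  proof (cases "m \<le> n")
    case True then show ?thesis using norm_diff that by blast
  next
    case False
    have "L2_inner G len (?d m n) (?d m n) = L2_inner G len (?d n m) (?d n m)"
      by (simp add: L2_inner_def algebra_simps)
    then show ?thesis using norm_diff[of n m] that False by simp
  qed
  then show "\<exists>N. \<forall>m\<ge>N. \<forall>n\<ge>N. L2_inner G len (?d m n) (?d m n) < \<epsilon>" by blast
qed simp

lemma coef_of_series:
  assumes lim: "L2_tendsto G len (\<lambda>n. combination {..<n} c) f"
  shows "coef f i = c i"
proof (rule LIMSEQ_unique)
  show "(\<lambda>n. coef (combination {..<n} c) i) \<longlonglongrightarrow> coef f i"
    by (rule L2_tendsto_inner[OF lim]) auto
  have "\<forall>\<^sub>F n in sequentially. coef (combination {..<n} c) i = c i"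
    using eventually_gt_at_top[of i] by eventually_elim (simp add: coef_combination)
  then show "(\<lambda>n. coef (combination {..<n} c) i) \<longlonglongrightarrow> c i"
    by (rule tendsto_eventually)
qed

end


section \<open>Fractional powers as bijections onto the dual spaces\<close>

context graph_eigenbasis
begin

lemma lam_powr_half_square: "(lam i powr (s / 2))\<^sup>2 = lam i powr s"
  by (simp add: power2_eq_square flip: powr_add)

lemma lam_powr_half_cancel: "lam i powr (- s / 2) * lam i powr (s / 2) = 1"
  using lam_pos[of i] by (simp flip: powr_add del: lam_pos)

lemma weighted_square: "lam i powr s * x\<^sup>2 = (lam i powr (s / 2) * x)\<^sup>2"
  by (simp add: power_mult_distrib lam_powr_half_square)

lemma Hdot_in_L2: "\<psi> \<in> Hdot G len \<phi> lam s \<Longrightarrow> \<psi> \<in> L2 G len"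
  by (simp add: Hdot_def)

lemma Hdot_summable:
  "\<psi> \<in> Hdot G len \<phi> lam s \<Longrightarrow> summable (\<lambda>i. (lam i powr (s / 2) * coef \<psi> i)\<^sup>2)"
  by (simp add: Hdot_def weighted_square)

lemma Hdot_norm_eq: "Hdot_norm G len \<phi> lam s \<psi> = sqrt (\<Sum>i. (lam i powr (s / 2) * coef \<psi> i)\<^sup>2)"
  by (simp add: Hdot_norm_def weighted_square)

lemma Hdot_add:
  assumes "\<psi> \<in> Hdot G len \<phi> lam s" "\<eta> \<in> Hdot G len \<phi> lam s"
  shows "(\<lambda>e x. \<psi> e x + \<eta> e x) \<in> Hdot G len \<phi> lam s"
proof -
  let ?a = "\<lambda>i. lam i powr (s / 2) * coef \<psi> i" and ?b = "\<lambda>i. lam i powr (s / 2) * coef \<eta> i"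
  have "summable (\<lambda>i. (?a i)\<^sup>2 + (?b i)\<^sup>2 + 2 * (?a i * ?b i))"
    by (intro summable_add summable_mult summable_mult_of_squares Hdot_summable assms)
  also have "(\<lambda>i. (?a i)\<^sup>2 + (?b i)\<^sup>2 + 2 * (?a i * ?b i)) = (\<lambda>i. (lam i powr (s / 2) * (coef \<psi> i + coef \<eta> i))\<^sup>2)"
    by (intro ext) (simp add: power2_eq_square algebra_simps)
  finally show ?thesis
    using assms[THEN Hdot_in_L2] by (simp add: Hdot_def L2_add coef_add weighted_square)
qed

lemma Hdot_scale:
  assumes "\<psi> \<in> Hdot G len \<phi> lam s"
  shows "(\<lambda>e x. c * \<psi> e x) \<in> Hdot G len \<phi> lam s"
  using assms summable_mult[of "\<lambda>i. lam i powr s * (coef \<psi> i)\<^sup>2" "c\<^sup>2"]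
  by (simp add: Hdot_def L2_scale coef_scale power_mult_distrib mult_ac)

lemma combination_in_Hdot [simp]:
  "finite I \<Longrightarrow> combination I c \<in> Hdot G len \<phi> lam s"
  unfolding Hdot_def by (auto simp: coef_combination intro!: summable_finite[of I])

lemma Hdot_norm_combination:
  "finite I \<Longrightarrow> Hdot_norm G len \<phi> lam s (combination I c) = sqrt (\<Sum>i\<in>I. lam i powr s * (c i)\<^sup>2)"
  unfolding Hdot_norm_def by (subst suminf_finite[of I]) (auto simp: coef_combination)

lemma basis_in_Hdot [simp]: "\<phi> i \<in> Hdot G len \<phi> lam s"
  using combination_in_Hdot[of "{i}" "\<lambda>_. 1" s] by simp

text \<open>
  Justifies the choice in \<^const>\<open>L_power\<close>: on \<open>Hdot s\<close> the defining series converges, and from here on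
  only its coefficients matter.
\<close>

lemma L_power_coef:
  assumes \<psi>: "\<psi> \<in> Hdot G len \<phi> lam s"
  shows "L_power G len \<phi> lam (s / 2) \<psi> \<in> L2 G len"
    and "coef (L_power G len \<phi> lam (s / 2) \<psi>) i = lam i powr (s / 2) * coef \<psi> i"
proof -
  have "\<exists>f. L2_tendsto G len (\<lambda>n. combination {..<n} (\<lambda>i. lam i powr (s / 2) * coef \<psi> i)) f"
    by (rule square_summable_series_converges) (rule Hdot_summable[OF \<psi>])
  then have lim: "L2_tendsto G len (\<lambda>n. combination {..<n} (\<lambda>i. lam i powr (s / 2) * coef \<psi> i))
      (L_power G len \<phi> lam (s / 2) \<psi>)"
    unfolding L_power_def L2_lim_def by (rule someI_ex)
  then show "L_power G len \<phi> lam (s / 2) \<psi> \<in> L2 G len"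
    by (simp add: L2_tendsto_def)
  from lim show "coef (L_power G len \<phi> lam (s / 2) \<psi>) i = lam i powr (s / 2) * coef \<psi> i"
    by (rule coef_of_series)
qed

lemma Hdot_dual_cong:
  assumes "F \<in> Hdot_dual G len \<phi> lam s" "\<And>\<psi>. \<psi> \<in> Hdot G len \<phi> lam s \<Longrightarrow> F' \<psi> = F \<psi>"
  shows "F' \<in> Hdot_dual G len \<phi> lam s"
  using assms by (simp add: Hdot_dual_def Hdot_add Hdot_scale)

text \<open>
  The Cauchy-Schwarz inequality after distributing the weight as
  \<open>1 = lam i powr (- s / 2) * lam i powr (s / 2)\<close>. This is how both the noise and the images of \<open>L2\<close>
  under fractional powers are recognised as elements of the dual.
\<close>

lemma coefficient_functional_summable:
  assumes c: "summable (\<lambda>i. lam i powr (- s) * (c i)\<^sup>2)" and \<psi>: "\<psi> \<in> Hdot G len \<phi> lam s"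
  shows "summable (\<lambda>i. c i * coef \<psi> i)"
    and "\<bar>\<Sum>i. c i * coef \<psi> i\<bar> \<le> sqrt (\<Sum>i. lam i powr (- s) * (c i)\<^sup>2) * Hdot_norm G len \<phi> lam s \<psi>"
proof -
  have split: "c i * coef \<psi> i = (lam i powr (- s / 2) * c i) * (lam i powr (s / 2) * coef \<psi> i)" for i
    using lam_powr_half_cancel[of i s] by (simp add: mult.assoc mult.left_commute[of _ "c i"])
  have c': "summable (\<lambda>i. (lam i powr (- s / 2) * c i)\<^sup>2)"
    using c unfolding weighted_square .
  show "summable (\<lambda>i. c i * coef \<psi> i)"
    unfolding split by (intro summable_mult_of_squares c' Hdot_summable \<psi>)
  show "\<bar>\<Sum>i. c i * coef \<psi> i\<bar> \<le> sqrt (\<Sum>i. lam i powr (- s) * (c i)\<^sup>2) * Hdot_norm G len \<phi> lam s \<psi>"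
    unfolding split Hdot_norm_eq weighted_square
    by (intro Cauchy_Schwarz_suminf c' Hdot_summable \<psi>)
qed

lemma coefficient_functional_in_dual:
  assumes c: "summable (\<lambda>i. lam i powr (- s) * (c i)\<^sup>2)"
  shows "(\<lambda>\<psi>. \<Sum>i. c i * coef \<psi> i) \<in> Hdot_dual G len \<phi> lam s"
  unfolding Hdot_dual_def
proof (intro CollectI conjI ballI allI)
  show "(\<Sum>i. c i * coef (\<lambda>e x. \<psi> e x + \<eta> e x) i) = (\<Sum>i. c i * coef \<psi> i) + (\<Sum>i. c i * coef \<eta> i)"
    if "\<psi> \<in> Hdot G len \<phi> lam s" "\<eta> \<in> Hdot G len \<phi> lam s" for \<psi> \<eta>
    using that[THEN Hdot_in_L2] that[THEN coefficient_functional_summable(1)[OF c]]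
    by (simp add: coef_add distrib_left suminf_add)
  show "(\<Sum>i. c i * coef (\<lambda>e x. a * \<psi> e x) i) = a * (\<Sum>i. c i * coef \<psi> i)"
    if "\<psi> \<in> Hdot G len \<phi> lam s" for a \<psi>
    using suminf_mult[OF coefficient_functional_summable(1)[OF c that], of a]
    by (simp add: coef_scale mult_ac)
  show "\<exists>C. \<forall>\<psi>\<in>Hdot G len \<phi> lam s. \<bar>\<Sum>i. c i * coef \<psi> i\<bar> \<le> C * Hdot_norm G len \<phi> lam s \<psi>"
    using coefficient_functional_summable(2)[OF c] by blast
qed

lemma coefficient_functional_basis: "(\<Sum>j. c j * coef (\<phi> i) j) = c i"
  by (subst suminf_finite[of "{i}"]) (auto simp: orthonormal)

lemma Hdot_dual_add:
  "F \<in> Hdot_dual G len \<phi> lam s \<Longrightarrow> \<psi> \<in> Hdot G len \<phi> lam s \<Longrightarrow> \<eta> \<in> Hdot G len \<phi> lam s \<Longrightarrow>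
    F (\<lambda>e x. \<psi> e x + \<eta> e x) = F \<psi> + F \<eta>"
  by (simp add: Hdot_dual_def)

lemma Hdot_dual_scale:
  "F \<in> Hdot_dual G len \<phi> lam s \<Longrightarrow> \<psi> \<in> Hdot G len \<phi> lam s \<Longrightarrow> F (\<lambda>e x. c * \<psi> e x) = c * F \<psi>"
  by (simp add: Hdot_dual_def)

lemma Hdot_dual_combination:
  assumes F: "F \<in> Hdot_dual G len \<phi> lam s" and "finite I"
  shows "F (combination I c) = (\<Sum>i\<in>I. c i * F (\<phi> i))"
  using \<open>finite I\<close>
proof (induction I rule: finite_induct)
  case empty
  from Hdot_dual_scale[OF F basis_in_Hdot[of 0], of 0] show ?case by simp
next
  case (insert i I)
  have "F (combination (insert i I) c) = F (\<lambda>e x. c i * \<phi> i e x + combination I c e x)"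
    using insert by simp
  also have "\<dots> = F (\<lambda>e x. c i * \<phi> i e x) + F (combination I c)"
    by (intro Hdot_dual_add[OF F] Hdot_scale basis_in_Hdot combination_in_Hdot insert)
  also have "F (\<lambda>e x. c i * \<phi> i e x) = c i * F (\<phi> i)"
    by (rule Hdot_dual_scale[OF F basis_in_Hdot])
  finally show ?case using insert by simp
qed

text \<open>
  Testing \<open>F\<close> with the combination \<open>\<Sum>i<n. lam i powr (- s) * F (\<phi> i) * \<phi> i\<close>, its Riesz representative
  cut off at \<open>n\<close>, gives \<open>A \<le> C * sqrt A\<close> for the \<open>n\<close>-th partial sum \<open>A\<close>, where \<open>C\<close> bounds \<open>F\<close>.
\<close>

lemma Hdot_dual_summable:
  assumes F: "F \<in> Hdot_dual G len \<phi> lam s"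
  shows "summable (\<lambda>i. lam i powr (- s) * (F (\<phi> i))\<^sup>2)"
proof -
  obtain C where C: "\<And>\<psi>. \<psi> \<in> Hdot G len \<phi> lam s \<Longrightarrow> \<bar>F \<psi>\<bar> \<le> C * Hdot_norm G len \<phi> lam s \<psi>"
    using F unfolding Hdot_dual_def by blast
  have "(\<Sum>i<n. lam i powr (- s) * (F (\<phi> i))\<^sup>2) \<le> C\<^sup>2" for n
  proof -
    define A where "A = (\<Sum>i<n. lam i powr (- s) * (F (\<phi> i))\<^sup>2)"
    have A: "0 \<le> A" unfolding A_def by (intro sum_nonneg) simp
    let ?\<psi> = "combination {..<n} (\<lambda>i. lam i powr (- s) * F (\<phi> i))"
    have "F ?\<psi> = A"
      unfolding Hdot_dual_combination[OF F finite_lessThan] A_def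
      by (simp add: power2_eq_square mult.assoc)
    moreover have "lam i powr s * (lam i powr (- s) * F (\<phi> i))\<^sup>2 = lam i powr (- s) * (F (\<phi> i))\<^sup>2" for i
      using lam_powr_pos[of i s]
      by (simp del: lam_powr_pos add: power_mult_distrib power2_eq_square powr_minus)
    then have "Hdot_norm G len \<phi> lam s ?\<psi> = sqrt A"
      by (simp add: Hdot_norm_combination A_def)
    ultimately have "A \<le> C * sqrt A"
      using C[of ?\<psi>] A by simp
    then have "A\<^sup>2 \<le> (C * sqrt A)\<^sup>2" using A by (intro power_mono) auto
    then have "A\<^sup>2 \<le> C\<^sup>2 * A" using A by (simp add: power_mult_distrib)
    then have "A * A \<le> C\<^sup>2 * A" by (simp add: power2_eq_square[of A])
    then show ?thesis
      using A unfolding A_def[symmetric] by (cases "A = 0") auto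
  qed
  then show ?thesis
    by (intro summableI_nonneg_bounded[of _ "C\<^sup>2"]) auto
qed

text \<open>
  The error of the \<open>n\<close>-th partial sum is \<open>F\<close> applied to the remainder of the expansion of \<open>\<psi>\<close>. It
  vanishes in the limit because \<open>F\<close> is bounded and the squared \<open>Hdot\<close> norms of the remainders are the
  tails of a convergent series.
\<close>

lemma Hdot_dual_expansion:
  assumes F: "F \<in> Hdot_dual G len \<phi> lam s" and \<psi>: "\<psi> \<in> Hdot G len \<phi> lam s"
  shows "(\<lambda>i. coef \<psi> i * F (\<phi> i)) sums F \<psi>"
proof -
  obtain C where C: "\<And>\<psi>. \<psi> \<in> Hdot G len \<phi> lam s \<Longrightarrow> \<bar>F \<psi>\<bar> \<le> C * Hdot_norm G len \<phi> lam s \<psi>"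
    using F unfolding Hdot_dual_def by blast
  let ?S = "\<lambda>n. combination {..<n} (coef \<psi>)"
  let ?a = "\<lambda>i. lam i powr s * (coef \<psi> i)\<^sup>2"
  have R: "(\<lambda>e x. \<psi> e x + (- 1) * ?S n e x) \<in> Hdot G len \<phi> lam s" for n
    by (intro Hdot_add Hdot_scale \<psi> combination_in_Hdot) simp
  have F_R: "F (\<lambda>e x. \<psi> e x + (- 1) * ?S n e x) = F \<psi> - F (?S n)" for n
  proof -
    have S: "?S n \<in> Hdot G len \<phi> lam s" by simp
    show ?thesis
      unfolding Hdot_dual_add[OF F \<psi> Hdot_scale[OF S]] Hdot_dual_scale[OF F S] by simp
  qed
  have coef_R: "coef (\<lambda>e x. \<psi> e x + (- 1) * ?S n e x) i = (if i < n then 0 else coef \<psi> i)" for n i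
    unfolding coef_add[OF Hdot_in_L2[OF \<psi>] L2_scale[OF combination_in_L2[OF finite_lessThan]]]
      coef_scale coef_combination[OF finite_lessThan]
    by simp
  have "\<bar>F (?S n) - F \<psi>\<bar> \<le> C * sqrt (\<Sum>i. if i < n then 0 else ?a i)" for n
  proof -
    have "Hdot_norm G len \<phi> lam s (\<lambda>e x. \<psi> e x + (- 1) * ?S n e x) = sqrt (\<Sum>i. if i < n then 0 else ?a i)"
      unfolding Hdot_norm_def coef_R by (intro arg_cong[where f = sqrt] suminf_cong) simp
    with C[OF R, of n] F_R[of n] show ?thesis by (simp add: abs_minus_commute)
  qed
  moreover have "(\<lambda>n. C * sqrt (\<Sum>i. if i < n then 0 else ?a i)) \<longlonglongrightarrow> C * sqrt 0"
    using \<psi> by (intro tendsto_intros suminf_tail_tendsto_0) (simp add: Hdot_def)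
  ultimately have "(\<lambda>n. F (?S n) - F \<psi>) \<longlonglongrightarrow> 0"
    by (intro Lim_null_comparison[of "\<lambda>n. F (?S n) - F \<psi>"]) auto
  then have "(\<lambda>n. F (?S n)) \<longlonglongrightarrow> F \<psi>"
    by (rule LIM_zero_cancel)
  then show ?thesis
    by (simp add: sums_def Hdot_dual_combination[OF F])
qed

lemma Hdot_dual_eqI:
  assumes F: "F \<in> Hdot_dual G len \<phi> lam s" and F': "F' \<in> Hdot_dual G len \<phi> lam s"
    and eq: "\<And>i. F (\<phi> i) = F' (\<phi> i)"
  shows "Hdot_dual_eq G len \<phi> lam s F F'"
  unfolding Hdot_dual_eq_def
  using F F' Hdot_dual_expansion[OF F] Hdot_dual_expansion[OF F'] by (auto simp: eq intro: sums_unique2)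

lemma L_power_ext_series:
  assumes "u \<in> L2 G len" "\<psi> \<in> Hdot G len \<phi> lam s"
  shows "L_power_ext G len \<phi> lam (s / 2) u \<psi> = (\<Sum>i. (lam i powr (s / 2) * coef u i) * coef \<psi> i)"
  using Parseval[OF assms(1) L_power_coef(1)[OF assms(2)]]
  by (simp add: L_power_ext_def L_power_coef(2)[OF assms(2)] sums_iff mult_ac)

lemma L_power_ext_basis:
  "u \<in> L2 G len \<Longrightarrow> L_power_ext G len \<phi> lam (s / 2) u (\<phi> i) = lam i powr (s / 2) * coef u i"
  by (simp only: L_power_ext_series basis_in_Hdot coefficient_functional_basis)

lemma L_power_ext_in_dual:
  assumes u: "u \<in> L2 G len"
  shows "L_power_ext G len \<phi> lam (s / 2) u \<in> Hdot_dual G len \<phi> lam s"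
proof (rule Hdot_dual_cong)
  have "lam i powr (- s) * (lam i powr (s / 2) * coef u i)\<^sup>2 = (coef u i)\<^sup>2" for i
    using lam_powr_pos[of i s] by (simp del: lam_powr_pos add: power_mult_distrib lam_powr_half_square powr_minus)
  then show "(\<lambda>\<psi>. \<Sum>i. (lam i powr (s / 2) * coef u i) * coef \<psi> i) \<in> Hdot_dual G len \<phi> lam s"
    using summable_coef_squares[OF u] by (intro coefficient_functional_in_dual) simp
qed (rule L_power_ext_series[OF u])

text \<open>
  Evaluating the equation at \<open>\<phi> i\<close> forces \<open>\<tau> * lam i powr (s / 2) * coef u i = F (\<phi> i)\<close>, and
  evaluations at the basis determine an element of the dual. The coefficients of \<open>u\<close> so obtained are
  square summable exactly because \<open>F\<close> is bounded on \<open>Hdot s\<close>.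
\<close>

theorem fractional_equation_unique_solution:
  assumes "\<tau> \<noteq> 0" and F: "F \<in> Hdot_dual G len \<phi> lam s"
  shows "\<exists>u\<in>L2 G len.
    Hdot_dual_eq G len \<phi> lam s (L_power_ext G len \<phi> lam (s / 2) (\<lambda>e x. \<tau> * u e x)) F \<and>
    (\<forall>v\<in>L2 G len. Hdot_dual_eq G len \<phi> lam s (L_power_ext G len \<phi> lam (s / 2) (\<lambda>e x. \<tau> * v e x)) F
       \<longrightarrow> L2_eq G len v u)"
proof -
  define c where "c i = lam i powr (- s / 2) * F (\<phi> i) / \<tau>" for i
  have "(c i)\<^sup>2 = (lam i powr (- s) * (F (\<phi> i))\<^sup>2) / \<tau>\<^sup>2" for i
    by (simp add: c_def weighted_square power_divide)
  then have "summable (\<lambda>i. (c i)\<^sup>2)"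
    using Hdot_dual_summable[OF F] by (simp add: summable_divide)
  then obtain u where lim: "L2_tendsto G len (\<lambda>n. combination {..<n} c) u"
    using square_summable_series_converges by blast
  have u: "u \<in> L2 G len" using lim by (simp add: L2_tendsto_def)
  have c_cancel: "lam i powr (s / 2) * (\<tau> * c i) = F (\<phi> i)" for i
    using lam_powr_half_cancel[of i s] \<open>\<tau> \<noteq> 0\<close>
    by (simp add: c_def mult.commute[of "lam i powr (s / 2)"] flip: mult.assoc)
  have coef_sol: "coef v i = c i"
    if v: "v \<in> L2 G len" and
      eq: "Hdot_dual_eq G len \<phi> lam s (L_power_ext G len \<phi> lam (s / 2) (\<lambda>e x. \<tau> * v e x)) F" for v i
  proof -
    have "lam i powr (s / 2) * (\<tau> * coef v i) = F (\<phi> i)"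
      using eq L_power_ext_basis[OF L2_scale[OF v], of s \<tau> i]
      by (simp add: Hdot_dual_eq_def coef_scale)
    then have "lam i powr (s / 2) * (\<tau> * coef v i) = lam i powr (s / 2) * (\<tau> * c i)"
      by (simp only: c_cancel)
    then show ?thesis
      using \<open>\<tau> \<noteq> 0\<close> lam_powr_pos[of i "s / 2"] by (simp del: lam_powr_pos)
  qed
  show ?thesis
  proof (intro bexI[OF _ u] conjI ballI impI)
    show "Hdot_dual_eq G len \<phi> lam s (L_power_ext G len \<phi> lam (s / 2) (\<lambda>e x. \<tau> * u e x)) F"
      by (rule Hdot_dual_eqI)
        (simp_all only: L_power_ext_in_dual L2_scale u F L_power_ext_basis coef_scale coef_of_series[OF lim] c_cancel)
    show "L2_eq G len v u"
      if "v \<in> L2 G len" "Hdot_dual_eq G len \<phi> lam s (L_power_ext G len \<phi> lam (s / 2) (\<lambda>e x. \<tau> * v e x)) F" for v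
      using that by (intro L2_eq_of_coef u) (simp_all add: coef_sol coef_of_series[OF lim])
  qed
qed

end


section \<open>A lower bound for the eigenvalues\<close>

lemma lebesgue_integral_Icc_eq_integral:
  fixes f :: "real \<Rightarrow> real"
  assumes "continuous_on {a..b} f"
  shows "(LINT x|lebesgue_on {a..b}. f x) = integral {a..b} f"
  by (rule lebesgue_integral_eq_integral[OF continuous_imp_integrable_real[OF assms]]) simp

lemma continuous_imp_square_integrable:
  assumes "continuous_on {0..l} f"
  shows "square_integrable l f"
  unfolding square_integrable_def using assms
  by (auto intro!: continuous_imp_integrable_real continuous_intros
      continuous_imp_measurable_on_sets_lebesgue)

lemma has_real_derivative_imp_continuous_on:
  fixes f :: "real \<Rightarrow> real"
  assumes "\<And>x. x \<in> S \<Longrightarrow> (f has_real_derivative f' x) (at x within S)"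
  shows "continuous_on S f"
  using assms by (meson DERIV_continuous continuous_on_eq_continuous_within)

lemma has_integral_derivative_Icc:
  fixes F :: "real \<Rightarrow> real"
  assumes F: "\<And>x. x \<in> {0..l} \<Longrightarrow> (F has_real_derivative F' x) (at x within {0..l})"
    and "0 \<le> a" "a \<le> b" "b \<le> l"
  shows "(F' has_integral (F b - F a)) {a..b}"
proof (rule fundamental_theorem_of_calculus[OF \<open>a \<le> b\<close>])
  fix x assume "x \<in> {a..b}"
  then have "(F has_real_derivative F' x) (at x within {a..b})"
    using assms by (intro DERIV_subset[OF F]) auto
  then show "(F has_vector_derivative F' x) (at x within {a..b})"
    by (simp add: has_real_derivative_iff_has_vector_derivative)
qed

text \<open>
  Recovers classical derivatives from the integral formulation of weak ones.
\<close>

lemma primitive_has_real_derivative: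
  fixes f g :: "real \<Rightarrow> real"
  assumes g: "continuous_on {0..l} g"
    and f: "\<And>x. x \<in> {0..l} \<Longrightarrow> f x = f 0 + (LINT t|lebesgue_on {0..x}. g t)"
    and x: "x \<in> {0..l}"
  shows "(f has_real_derivative g x) (at x within {0..l})"
proof -
  have "((\<lambda>x. f 0 + integral {0..x} g) has_real_derivative g x) (at x within {0..l})"
    using integral_has_real_derivative[OF g x] by (auto intro!: derivative_eq_intros)
  moreover have "f y = f 0 + integral {0..y} g" if "y \<in> {0..l}" for y
  proof -
    have "continuous_on {0..y} g"
      using that by (intro continuous_on_subset[OF g]) auto
    then show ?thesis
      using f[OF that] by (simp only: lebesgue_integral_Icc_eq_integral)
  qed
  ultimately show ?thesis
    unfolding has_field_derivative_def by (rule has_derivative_transform[OF x, rotated])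
qed

text \<open>
  The function \<open>f\<^sup>2\<close> oscillates by at most \<open>\<integral>2\<bar>f f'\<bar>\<close>, hence exceeds its mean by no more than that,
  and \<open>2\<bar>f f'\<bar> \<le> f\<^sup>2 / \<delta> + \<delta> f'\<^sup>2\<close>.
\<close>

lemma pointwise_square_bound:
  fixes f f' :: "real \<Rightarrow> real"
  assumes f: "\<And>x. x \<in> {0..l} \<Longrightarrow> (f has_real_derivative f' x) (at x within {0..l})"
    and f': "continuous_on {0..l} f'" and "l > 0" "\<delta> > 0" and x: "x \<in> {0..l}"
  shows "(f x)\<^sup>2 \<le> (1 / l + 1 / \<delta>) * (LINT t|lebesgue_on {0..l}. (f t)\<^sup>2)
           + \<delta> * (LINT t|lebesgue_on {0..l}. (f' t)\<^sup>2)"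
proof -
  have cont: "continuous_on {0..l} f"
    using f by (rule has_real_derivative_imp_continuous_on)
  define k where "k t = (f t)\<^sup>2 / \<delta> + \<delta> * (f' t)\<^sup>2" for t
  define B where "B = integral {0..l} k"
  have k_cont: "continuous_on {0..l} k"
    unfolding k_def using \<open>\<delta> > 0\<close> by (intro continuous_intros cont f') auto
  have k_nonneg: "0 \<le> k t" for t
    unfolding k_def using \<open>\<delta> > 0\<close> by simp
  have deriv_bound: "\<bar>2 * f t * f' t\<bar> \<le> k t" for t
  proof -
    have "2 * \<bar>f t\<bar> * (\<delta> * \<bar>f' t\<bar>) \<le> (f t)\<^sup>2 + (\<delta> * \<bar>f' t\<bar>)\<^sup>2"
      using sum_squares_bound[of "\<bar>f t\<bar>" "\<delta> * \<bar>f' t\<bar>"] by simp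
    also have "2 * \<bar>f t\<bar> * (\<delta> * \<bar>f' t\<bar>) = \<delta> * \<bar>2 * f t * f' t\<bar>"
      by (simp add: abs_mult)
    also have "(f t)\<^sup>2 + (\<delta> * \<bar>f' t\<bar>)\<^sup>2 = \<delta> * k t"
      using \<open>\<delta> > 0\<close> by (simp add: k_def distrib_left power_mult_distrib power2_eq_square[of \<delta>])
    finally show ?thesis using \<open>\<delta> > 0\<close> by simp
  qed
  have square_deriv: "((\<lambda>t. (f t)\<^sup>2) has_real_derivative 2 * f t * f' t) (at t within {0..l})"
    if "t \<in> {0..l}" for t
    using f[OF that] by (auto intro!: derivative_eq_intros)
  have osc: "\<bar>(f b)\<^sup>2 - (f a)\<^sup>2\<bar> \<le> B" if "0 \<le> a" "a \<le> b" "b \<le> l" for a b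
  proof -
    have I: "((\<lambda>t. 2 * f t * f' t) has_integral ((f b)\<^sup>2 - (f a)\<^sup>2)) {a..b}"
      by (rule has_integral_derivative_Icc[OF square_deriv that])
    have k_ab: "k integrable_on {a..b}"
      using that by (intro integrable_continuous_interval continuous_on_subset[OF k_cont]) auto
    have "norm (integral {a..b} (\<lambda>t. 2 * f t * f' t)) \<le> integral {a..b} k"
      using I k_ab deriv_bound by (intro integral_norm_bound_integral) auto
    also have "\<dots> \<le> B"
      unfolding B_def using that k_nonneg
      by (intro integral_subset_le k_ab integrable_continuous_interval[OF k_cont]) auto
    finally show ?thesis using I by (simp add: integral_unique)
  qed
  have "integral {0..l} (\<lambda>y. (f x)\<^sup>2 - B) \<le> integral {0..l} (\<lambda>y. (f y)\<^sup>2)"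
  proof (rule integral_le)
    show "(\<lambda>y. (f y)\<^sup>2) integrable_on {0..l}"
      by (intro integrable_continuous_interval continuous_intros cont)
    show "(f x)\<^sup>2 - B \<le> (f y)\<^sup>2" if "y \<in> {0..l}" for y
      using osc[of x y] osc[of y x] x that by (cases "x \<le> y") auto
  qed auto
  then have "l * ((f x)\<^sup>2 - B) \<le> integral {0..l} (\<lambda>y. (f y)\<^sup>2)"
    using \<open>l > 0\<close> by simp
  then have "(f x)\<^sup>2 \<le> (1 / l) * integral {0..l} (\<lambda>y. (f y)\<^sup>2) + B"
    using \<open>l > 0\<close> by (simp add: field_simps)
  also have "B = (1 / \<delta>) * integral {0..l} (\<lambda>y. (f y)\<^sup>2) + \<delta> * integral {0..l} (\<lambda>y. (f' y)\<^sup>2)"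
  proof -
    have "B = integral {0..l} (\<lambda>t. (f t)\<^sup>2 / \<delta>) + integral {0..l} (\<lambda>t. \<delta> * (f' t)\<^sup>2)"
      unfolding B_def k_def using \<open>\<delta> > 0\<close>
      by (intro Henstock_Kurzweil_Integration.integral_add integrable_continuous_interval continuous_intros cont f') auto
    then show ?thesis by simp
  qed
  finally have "(f x)\<^sup>2 \<le> (1 / l + 1 / \<delta>) * integral {0..l} (\<lambda>y. (f y)\<^sup>2) + \<delta> * integral {0..l} (\<lambda>y. (f' y)\<^sup>2)"
    by (simp add: distrib_right)
  moreover have "continuous_on {0..l} (\<lambda>y. (f y)\<^sup>2)" "continuous_on {0..l} (\<lambda>y. (f' y)\<^sup>2)"
    by (intro continuous_intros cont f')+
  ultimately show ?thesis
    by (simp only: lebesgue_integral_Icc_eq_integral)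
qed

context graph_eigenbasis
begin

text \<open>
  Classical form of the eigenvalue equation. For an eigenfunction the weak second derivative is almost
  everywhere a multiple of the eigenfunction itself and so may be taken continuous, which spares
  integration by parts for absolutely continuous functions.
\<close>

definition eigenfunction_deriv :: "nat \<Rightarrow> 'e graph_fun \<Rightarrow> bool" where
  "eigenfunction_deriv i d \<longleftrightarrow> kirchhoff_condition G len d \<and>
     (\<forall>e\<in>arcs G. \<forall>x\<in>{0..len e}.
        (\<phi> i e has_real_derivative d e x) (at x within {0..len e}) \<and>
        (d e has_real_derivative (\<kappa>\<^sup>2 - lam i) * \<phi> i e x) (at x within {0..len e}))"

lemma basis_continuous:
  shows "continuous_on_graph G len (\<phi> i)"
  using basis unfolding eigenbasis_def L_operator_def kirchhoff_laplacian_def by blast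

lemma ex_eigenfunction_deriv: "\<exists>d. eigenfunction_deriv i d"
proof -
  obtain h d where eq: "L2_eq G len (\<lambda>e x. lam i * \<phi> i e x) (\<lambda>e x. \<kappa>\<^sup>2 * \<phi> i e x - h e x)"
    and d: "\<And>e. e \<in> arcs G \<Longrightarrow> sobolev_deriv (len e) (\<phi> i e) (d e)"
    and h: "\<And>e. e \<in> arcs G \<Longrightarrow> sobolev_deriv (len e) (d e) (h e)"
    and K: "kirchhoff_condition G len d"
  proof -
    have "L_operator G len \<kappa> (\<phi> i) (\<lambda>e x. lam i * \<phi> i e x)"
      using basis unfolding eigenbasis_def by blast
    then show ?thesis
      using that unfolding L_operator_def kirchhoff_laplacian_def by blast
  qed
  have deriv: "(\<phi> i e has_real_derivative d e x) (at x within {0..len e}) \<and>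
      (d e has_real_derivative (\<kappa>\<^sup>2 - lam i) * \<phi> i e x) (at x within {0..len e})"
    if e: "e \<in> arcs G" and x: "x \<in> {0..len e}" for e x
  proof -
    have cont: "continuous_on {0..len e} (\<lambda>t. (\<kappa>\<^sup>2 - lam i) * \<phi> i e t)"
      using basis_continuous[of i] e
      by (auto simp: continuous_on_graph_def intro!: continuous_intros)
    have h_eq: "AE t in lebesgue_on {0..len e}. h e t = (\<kappa>\<^sup>2 - lam i) * \<phi> i e t"
      using eq e unfolding L2_eq_def by (auto elim!: AE_mp simp: algebra_simps)
    have d_eq: "d e y = d e 0 + (LINT t|lebesgue_on {0..y}. (\<kappa>\<^sup>2 - lam i) * \<phi> i e t)"
      if y: "y \<in> {0..len e}" for y
    proof -
      have sub: "{0..y} \<subseteq> {0..len e}" using y by auto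
      have "(LINT t|lebesgue_on {0..y}. h e t) = (LINT t|lebesgue_on {0..y}. (\<kappa>\<^sup>2 - lam i) * \<phi> i e t)"
      proof (rule integral_cong_AE)
        have "h e \<in> borel_measurable (lebesgue_on {0..len e})"
          using h[OF e] by (simp add: sobolev_deriv_def square_integrable_def)
        then show "h e \<in> borel_measurable (lebesgue_on {0..y})"
          using sub by (rule measurable_restrict_mono)
        show "(\<lambda>t. (\<kappa>\<^sup>2 - lam i) * \<phi> i e t) \<in> borel_measurable (lebesgue_on {0..y})"
          by (intro continuous_imp_measurable_on_sets_lebesgue continuous_on_subset[OF cont sub]) simp
        show "AE t in lebesgue_on {0..y}. h e t = (\<kappa>\<^sup>2 - lam i) * \<phi> i e t"
          using h_eq sub by (auto simp: AE_restrict_space_iff elim!: AE_mp)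
      qed
      then show ?thesis
        using h[OF e] y unfolding sobolev_deriv_def by metis
    qed
    have d_deriv: "(d e has_real_derivative (\<kappa>\<^sup>2 - lam i) * \<phi> i e y) (at y within {0..len e})"
      if "y \<in> {0..len e}" for y
      by (rule primitive_has_real_derivative[OF cont d_eq that])
    have "continuous_on {0..len e} (d e)"
      by (rule has_real_derivative_imp_continuous_on[OF d_deriv])
    moreover have "\<phi> i e y = \<phi> i e 0 + (LINT t|lebesgue_on {0..y}. d e t)" if "y \<in> {0..len e}" for y
      using d[OF e] that unfolding sobolev_deriv_def by blast
    ultimately have "(\<phi> i e has_real_derivative d e x) (at x within {0..len e})"
      using x by (rule primitive_has_real_derivative)
    with d_deriv[OF x] show ?thesis by blast
  qed
  with K show ?thesis unfolding eigenfunction_deriv_def by blast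
qed

definition D\<phi> :: "nat \<Rightarrow> 'e graph_fun" where
  "D\<phi> i = (SOME d. eigenfunction_deriv i d)"

lemma D\<phi>: "eigenfunction_deriv i (D\<phi> i)"
  unfolding D\<phi>_def by (rule someI_ex[OF ex_eigenfunction_deriv])

lemma basis_deriv:
  assumes "e \<in> arcs G" "x \<in> {0..len e}"
  shows "(\<phi> i e has_real_derivative D\<phi> i e x) (at x within {0..len e})"
    and "(D\<phi> i e has_real_derivative (\<kappa>\<^sup>2 - lam i) * \<phi> i e x) (at x within {0..len e})"
  using D\<phi>[of i] assms by (auto simp: eigenfunction_deriv_def)

lemma D\<phi>_continuous: "e \<in> arcs G \<Longrightarrow> continuous_on {0..len e} (D\<phi> i e)"
  using basis_deriv(2) by (rule has_real_derivative_imp_continuous_on)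

lemma basis_continuous_edge: "e \<in> arcs G \<Longrightarrow> continuous_on {0..len e} (\<phi> i e)"
  using basis_continuous[of i] by (simp add: continuous_on_graph_def)

lemma D\<phi>_in_L2: "D\<phi> i \<in> L2 G len"
  by (simp add: L2_def continuous_imp_square_integrable D\<phi>_continuous)

text \<open>
  Collect the boundary terms by vertices. By continuity the values of \<open>\<phi> i\<close> at a vertex factor out, and
  the sum of the derivatives of \<open>\<phi> j\<close> that remains is the one in the Kirchhoff condition.
\<close>

lemma boundary_terms_cancel:
  "(\<Sum>e\<in>arcs G. \<phi> i e (len e) * D\<phi> j e (len e) - \<phi> i e 0 * D\<phi> j e 0) = 0"
proof -
  obtain val where val: "\<And>e. e \<in> arcs G \<Longrightarrow> \<phi> i e 0 = val (tail G e) \<and> \<phi> i e (len e) = val (head G e)"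
    using basis_continuous[of i] by (auto simp: continuous_on_graph_def)
  let ?d = "D\<phi> j"
  have "(\<Sum>e\<in>arcs G. val (head G e) * ?d e (len e)) = (\<Sum>v\<in>verts G. \<Sum>e | e \<in> arcs G \<and> head G e = v. val (head G e) * ?d e (len e))"
    by (rule sum.group[symmetric]) auto
  moreover have "(\<Sum>e\<in>arcs G. val (tail G e) * ?d e 0) = (\<Sum>v\<in>verts G. \<Sum>e | e \<in> arcs G \<and> tail G e = v. val (tail G e) * ?d e 0)"
    by (rule sum.group[symmetric]) auto
  ultimately have "(\<Sum>e\<in>arcs G. \<phi> i e (len e) * ?d e (len e) - \<phi> i e 0 * ?d e 0)
      = (\<Sum>v\<in>verts G. - val v * ((\<Sum>e\<in>out_arcs G v. ?d e 0) + (\<Sum>e\<in>in_arcs G v. - ?d e (len e))))"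
    by (simp add: val sum_subtractf sum_negf sum_distrib_left in_arcs_def out_arcs_def algebra_simps)
  also have "\<dots> = 0"
    using D\<phi>[of j] by (intro sum.neutral) (simp add: eigenfunction_deriv_def kirchhoff_condition_def)
  finally show ?thesis .
qed

text \<open>
  Integrate by parts on each edge, moving the derivative from \<open>\<phi> i\<close> to \<open>D\<phi> j\<close>, whose derivative is
  \<open>(\<kappa>\<^sup>2 - lam j) \<phi> j\<close>.
\<close>

lemma Dirichlet_form_basis:
  "L2_inner G len (D\<phi> i) (D\<phi> j) = (if i = j then lam i - \<kappa>\<^sup>2 else 0)"
proof -
  have parts: "(LINT x|lebesgue_on {0..len e}. D\<phi> i e x * D\<phi> j e x)
      = (\<phi> i e (len e) * D\<phi> j e (len e) - \<phi> i e 0 * D\<phi> j e 0)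
        + (lam j - \<kappa>\<^sup>2) * (LINT x|lebesgue_on {0..len e}. \<phi> i e x * \<phi> j e x)"
    if e: "e \<in> arcs G" for e
  proof -
    let ?l = "len e"
    have "((\<lambda>x. \<phi> i e x * D\<phi> j e x) has_real_derivative
        D\<phi> i e x * D\<phi> j e x + (\<kappa>\<^sup>2 - lam j) * (\<phi> i e x * \<phi> j e x)) (at x within {0..?l})"
      if "x \<in> {0..?l}" for x
      using basis_deriv[OF e that] by (auto intro!: derivative_eq_intros)
    then have "((\<lambda>x. D\<phi> i e x * D\<phi> j e x + (\<kappa>\<^sup>2 - lam j) * (\<phi> i e x * \<phi> j e x))
        has_integral (\<phi> i e ?l * D\<phi> j e ?l - \<phi> i e 0 * D\<phi> j e 0)) {0..?l}"
      using length_pos[OF e] by (intro has_integral_derivative_Icc) auto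
    then have "integral {0..?l} (\<lambda>x. D\<phi> i e x * D\<phi> j e x + (\<kappa>\<^sup>2 - lam j) * (\<phi> i e x * \<phi> j e x))
        = \<phi> i e ?l * D\<phi> j e ?l - \<phi> i e 0 * D\<phi> j e 0"
      by (rule integral_unique)
    also have "integral {0..?l} (\<lambda>x. D\<phi> i e x * D\<phi> j e x + (\<kappa>\<^sup>2 - lam j) * (\<phi> i e x * \<phi> j e x))
        = integral {0..?l} (\<lambda>x. D\<phi> i e x * D\<phi> j e x) + integral {0..?l} (\<lambda>x. (\<kappa>\<^sup>2 - lam j) * (\<phi> i e x * \<phi> j e x))"
      by (intro Henstock_Kurzweil_Integration.integral_add integrable_continuous_interval continuous_intros
          D\<phi>_continuous basis_continuous_edge e)
    also have "integral {0..?l} (\<lambda>x. (\<kappa>\<^sup>2 - lam j) * (\<phi> i e x * \<phi> j e x))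
        = (\<kappa>\<^sup>2 - lam j) * integral {0..?l} (\<lambda>x. \<phi> i e x * \<phi> j e x)"
      by (rule Henstock_Kurzweil_Integration.integral_mult_right)
    moreover have "continuous_on {0..?l} (\<lambda>x. D\<phi> i e x * D\<phi> j e x)" "continuous_on {0..?l} (\<lambda>x. \<phi> i e x * \<phi> j e x)"
      by (intro continuous_intros D\<phi>_continuous basis_continuous_edge e)+
    ultimately show ?thesis
      by (simp only: lebesgue_integral_Icc_eq_integral) (simp add: algebra_simps)
  qed
  have "L2_inner G len (D\<phi> i) (D\<phi> j) = (lam j - \<kappa>\<^sup>2) * L2_inner G len (\<phi> i) (\<phi> j)"
    using boundary_terms_cancel[of i j]
    unfolding L2_inner_def by (simp add: parts sum.distrib sum_distrib_left)
  then show ?thesis by (simp add: orthonormal)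
qed

text \<open>
  The function \<open>f = \<Sum>i\<le>n. \<phi> i e x * \<phi> i\<close> represents evaluation at \<open>x\<close> on the span of
  \<open>\<phi> 0, \<dots>, \<phi> n\<close>. Hence \<open>f e x\<close> and \<open>\<parallel>f\<parallel>\<^sup>2\<close> are both the left-hand side \<open>K\<close>, and the pointwise bound,
  which is quadratic in \<open>f e x\<close> but linear in the norms, becomes \<open>K * K \<le> const * K\<close>.
\<close>

lemma basis_squares_pointwise_bound:
  assumes e: "e \<in> arcs G" and x: "x \<in> {0..len e}"
  shows "(\<Sum>i\<le>n. (\<phi> i e x)\<^sup>2) \<le> 1 / len e + 2 * sqrt (lam n)"
proof -
  define c where "c i = \<phi> i e x" for i
  define K where "K = (\<Sum>i\<le>n. (c i)\<^sup>2)"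
  let ?f = "combination {..n} c" and ?g = "\<lambda>e x. \<Sum>i\<le>n. c i * D\<phi> i e x"
  \<comment> \<open>This \<open>\<delta>\<close> balances the terms \<open>K / \<delta>\<close> and \<open>\<delta> * lam n * K\<close>.\<close>
  define \<delta> where "\<delta> = 1 / sqrt (lam n)"
  have \<delta>: "\<delta> > 0" by (simp add: \<delta>_def)
  have K: "0 \<le> K" unfolding K_def by (intro sum_nonneg) simp
  have f_x: "?f e x = K"
    by (simp add: K_def c_def power2_eq_square)
  have "L2_inner G len ?f ?f = K"
    unfolding inner_combination[OF finite_atMost combination_in_L2[OF finite_atMost]]
      coef_combination[OF finite_atMost] K_def
    by (simp add: power2_eq_square)
  then have f_norm: "(LINT t|lebesgue_on {0..len e}. (?f e t)\<^sup>2) \<le> K"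
    using edge_integral_le_L2_inner[OF e, of ?f] by simp
  have "L2_inner G len ?g ?g = (\<Sum>i\<le>n. \<Sum>j\<le>n. c i * (c j * L2_inner G len (D\<phi> i) (D\<phi> j)))"
    by (subst L2_inner_sum_left)
      (auto simp: L2_inner_sum_right L2_scale L2_sum D\<phi>_in_L2 L2_inner_scale_left L2_inner_scale_right sum_distrib_left)
  also have "\<dots> = (\<Sum>i\<le>n. (lam i - \<kappa>\<^sup>2) * (c i)\<^sup>2)"
    by (simp add: Dirichlet_form_basis if_distrib power2_eq_square mult_ac cong: if_cong)
  also have "\<dots> \<le> (\<Sum>i\<le>n. lam n * (c i)\<^sup>2)"
  proof (intro sum_mono mult_right_mono)
    show "lam i - \<kappa>\<^sup>2 \<le> lam n" if "i \<in> {..n}" for i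
      by (rule order_trans[OF _ lam_mono]) (use that in auto)
  qed simp
  finally have "L2_inner G len ?g ?g \<le> lam n * K"
    by (simp add: K_def sum_distrib_left)
  then have g_norm: "(LINT t|lebesgue_on {0..len e}. (?g e t)\<^sup>2) \<le> lam n * K"
    using edge_integral_le_L2_inner[OF e, of ?g] by simp
  have "(?f e x)\<^sup>2 \<le> (1 / len e + 1 / \<delta>) * (LINT t|lebesgue_on {0..len e}. (?f e t)\<^sup>2)
           + \<delta> * (LINT t|lebesgue_on {0..len e}. (?g e t)\<^sup>2)"
  proof (rule pointwise_square_bound[OF _ _ length_pos[OF e] \<delta> x])
    show "(?f e has_real_derivative ?g e t) (at t within {0..len e})" if "t \<in> {0..len e}" for t
      by (intro DERIV_sum DERIV_cmult basis_deriv(1) e that)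
    show "continuous_on {0..len e} (?g e)"
      by (intro continuous_intros D\<phi>_continuous e)
  qed
  also have "\<dots> \<le> (1 / len e + 1 / \<delta>) * K + \<delta> * (lam n * K)"
    using \<delta> length_pos[OF e] by (intro add_mono mult_left_mono f_norm g_norm) auto
  also have "\<dots> = (1 / len e + 2 * sqrt (lam n)) * K"
  proof -
    have "\<delta> * lam n = sqrt (lam n)"
      using lam_pos[of n] by (simp add: \<delta>_def real_div_sqrt del: lam_pos)
    then have "\<delta> * (lam n * K) = sqrt (lam n) * K" by (simp flip: mult.assoc)
    then show ?thesis by (simp add: \<delta>_def algebra_simps)
  qed
  finally have "K * K \<le> (1 / len e + 2 * sqrt (lam n)) * K"
    unfolding f_x power2_eq_square .
  moreover have "0 \<le> 1 / len e + 2 * sqrt (lam n)"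
    using length_pos[OF e] lam_pos[of n] by (simp add: less_imp_le del: lam_pos)
  ultimately have "K \<le> 1 / len e + 2 * sqrt (lam n)"
    using K by (cases "K = 0") auto
  then show ?thesis by (simp add: K_def c_def)
qed

text \<open>
  Integrate the pointwise bound over the graph; each eigenfunction contributes its norm \<open>1\<close>.
\<close>

lemma Weyl_lower_bound:
  "real (Suc n) \<le> card (arcs G) + 2 * (\<Sum>e\<in>arcs G. len e) * sqrt (lam n)"
proof -
  have "real (Suc n) = (\<Sum>i\<le>n. L2_inner G len (\<phi> i) (\<phi> i))"
    by (simp add: orthonormal)
  also have "\<dots> = (\<Sum>e\<in>arcs G. \<Sum>i\<le>n. LINT x|lebesgue_on {0..len e}. (\<phi> i e x)\<^sup>2)"
    unfolding L2_inner_def power2_eq_square by (rule sum.swap)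
  also have "\<dots> \<le> (\<Sum>e\<in>arcs G. 1 + 2 * len e * sqrt (lam n))"
  proof (rule sum_mono)
    fix e assume e: "e \<in> arcs G"
    have cont: "continuous_on {0..len e} (\<lambda>x. (\<phi> i e x)\<^sup>2)" for i
      by (intro continuous_intros basis_continuous_edge e)
    have "(\<Sum>i\<le>n. LINT x|lebesgue_on {0..len e}. (\<phi> i e x)\<^sup>2) = integral {0..len e} (\<lambda>x. \<Sum>i\<le>n. (\<phi> i e x)\<^sup>2)"
      by (simp add: lebesgue_integral_Icc_eq_integral cont Henstock_Kurzweil_Integration.integral_sum
          integrable_continuous_interval)
    also have "\<dots> \<le> integral {0..len e} (\<lambda>x. 1 / len e + 2 * sqrt (lam n))"
      by (intro integral_le basis_squares_pointwise_bound[OF e] integrable_continuous_interval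
          continuous_intros cont) auto
    also have "\<dots> = 1 + 2 * len e * sqrt (lam n)"
      using length_pos[OF e] by (simp add: field_simps)
    finally show "(\<Sum>i\<le>n. LINT x|lebesgue_on {0..len e}. (\<phi> i e x)\<^sup>2) \<le> 1 + 2 * len e * sqrt (lam n)" .
  qed
  also have "\<dots> = card (arcs G) + 2 * (\<Sum>e\<in>arcs G. len e) * sqrt (lam n)"
    by (simp add: sum.distrib sum_distrib_left sum_distrib_right)
  finally show ?thesis .
qed

lemma summable_lam_powr:
  assumes "s > 1 / 2"
  shows "summable (\<lambda>n. lam n powr (- s))"
proof -
  define C where "C = card (arcs G) / sqrt (lam 0) + 2 * (\<Sum>e\<in>arcs G. len e)"
  have growth: "real (Suc n) \<le> C * sqrt (lam n)" for n
  proof -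
    have "1 \<le> sqrt (lam n) / sqrt (lam 0)"
      using lam_mono[of 0 n] lam_pos[of 0] by (simp del: lam_pos)
    then have "real (card (arcs G)) * 1 \<le> card (arcs G) * (sqrt (lam n) / sqrt (lam 0))"
      by (intro mult_left_mono) auto
    with Weyl_lower_bound[of n] show ?thesis
      by (simp add: C_def algebra_simps)
  qed
  have "0 < C * sqrt (lam 0)"
    using growth[of 0] by simp
  then have C: "0 < C"
    using lam_pos[of 0] by (simp add: zero_less_mult_iff del: lam_pos)
  have bound: "lam n powr (- s) \<le> C powr (2 * s) * real (Suc n) powr (- 2 * s)" for n
  proof -
    have "real (Suc n) / C \<le> sqrt (lam n)"
      using growth[of n] C by (simp add: field_simps)
    then have "sqrt (lam n) powr (- 2 * s) \<le> (real (Suc n) / C) powr (- 2 * s)"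
      using assms C by (intro powr_mono2') auto
    also have "\<dots> = C powr (2 * s) * real (Suc n) powr (- 2 * s)"
      using C by (simp add: powr_divide powr_minus divide_simps)
    also have "sqrt (lam n) powr (- 2 * s) = lam n powr (- s)"
      using lam_pos[of n] by (simp add: powr_half_sqrt[symmetric] powr_powr del: lam_pos)
    finally show ?thesis .
  qed
  have "summable (\<lambda>n. C powr (2 * s) * real (Suc n) powr (- 2 * s))"
  proof (rule summable_mult)
    have "summable (\<lambda>n. real n powr (- 2 * s))"
      using assms by (simp add: summable_real_powr_iff)
    then show "summable (\<lambda>n. real (Suc n) powr (- 2 * s))"
      by (subst summable_Suc_iff)
  qed
  then show ?thesis
    by (rule summable_comparison_test') (use bound in simp)
qed

end


section \<open>Convergence of the white noise series\<close>

lemma std_normal_second_moment: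
  assumes X: "distributed M lborel X std_normal_density"
  shows "(\<integral>\<^sup>+\<omega>. ennreal ((X \<omega>)\<^sup>2) \<partial>M) = 1"
proof -
  have "(\<integral>\<^sup>+\<omega>. ennreal ((X \<omega>)\<^sup>2) \<partial>M) = (\<integral>\<^sup>+x. ennreal (std_normal_density x) * ennreal (x\<^sup>2) \<partial>lborel)"
    by (rule distributed_nn_integral[OF X, symmetric]) simp
  also have "\<dots> = (\<integral>\<^sup>+x. ennreal (std_normal_density x * x\<^sup>2) \<partial>lborel)"
    by (simp add: ennreal_mult)
  also have "\<dots> = ennreal (\<integral>x. std_normal_density x * x\<^sup>2 \<partial>lborel)"
    using integrable_std_normal_moment[of 2] by (intro nn_integral_eq_integral) auto
  also have "(\<integral>x. std_normal_density x * x\<^sup>2 \<partial>lborel) = 1"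
    using integral_std_normal_moment_even[of 1] by (simp add: fact_numeral)
  finally show ?thesis by simp
qed

text \<open>
  One candidate serves all \<open>s > 1/2\<close> at once, as the definition of the noise demands. The squared dual
  norm of the error after \<open>n\<close> terms is \<open>\<Sum>i\<ge>n. lam i powr (-s) * (\<xi> i)\<^sup>2\<close>, whose expectation is a tail
  of \<open>\<Sum>i. lam i powr (-s)\<close>. The case \<open>n = 0\<close> of the same computation shows that the weighted squares
  are summable almost surely, so that the sum lies in the dual.
\<close>

lemma (in graph_eigenbasis) noise_series_converges:
  assumes \<xi>[measurable]: "\<And>i. \<xi> i \<in> borel_measurable M"
    and moment: "\<And>i. (\<integral>\<^sup>+\<omega>. ennreal ((\<xi> i \<omega>)\<^sup>2) \<partial>M) = 1"
    and s: "s > 1 / 2"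
  shows "noise_tendsto G len \<phi> lam M \<xi> s (\<lambda>\<omega> \<psi>. \<Sum>i. \<xi> i \<omega> * coef \<psi> i)"
proof -
  let ?W = "\<lambda>\<omega> \<psi>. \<Sum>i. \<xi> i \<omega> * coef \<psi> i"
  let ?t = "\<lambda>i \<omega>. lam i powr (- s) * (\<xi> i \<omega>)\<^sup>2"
  have term_moment: "(\<integral>\<^sup>+\<omega>. ennreal (?t i \<omega>) \<partial>M) = ennreal (lam i powr (- s))" for i
    by (simp add: ennreal_mult nn_integral_cmult moment)
  have tail_moment: "(\<integral>\<^sup>+\<omega>. (\<Sum>i. ennreal (if i < n then 0 else ?t i \<omega>)) \<partial>M)
      = ennreal (\<Sum>i. if i < n then 0 else lam i powr (- s))" for n
  proof -
    have "(\<integral>\<^sup>+\<omega>. (\<Sum>i. ennreal (if i < n then 0 else ?t i \<omega>)) \<partial>M)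
        = (\<Sum>i. \<integral>\<^sup>+\<omega>. ennreal (if i < n then 0 else ?t i \<omega>) \<partial>M)"
      by (rule nn_integral_suminf) measurable
    also have "\<dots> = (\<Sum>i. ennreal (if i < n then 0 else lam i powr (- s)))"
      by (intro suminf_cong) (simp add: term_moment)
    also have "\<dots> = ennreal (\<Sum>i. if i < n then 0 else lam i powr (- s))"
      by (intro suminf_ennreal2 summable_comparison_test'[OF summable_lam_powr[OF s]]) auto
    finally show ?thesis .
  qed
  have "(\<integral>\<^sup>+\<omega>. (\<Sum>i. ennreal (?t i \<omega>)) \<partial>M) \<noteq> \<infinity>"
    using tail_moment[of 0] by simp
  then have "AE \<omega> in M. (\<Sum>i. ennreal (?t i \<omega>)) \<noteq> \<infinity>"
    by (intro nn_integral_noteq_infinite) measurable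
  then have summable: "AE \<omega> in M. summable (\<lambda>i. ?t i \<omega>)"
  proof eventually_elim
    case (elim \<omega>)
    then show ?case
      unfolding infinity_ennreal_def by (intro summable_suminf_not_top) simp
  qed
  show ?thesis
    unfolding noise_tendsto_def
  proof (intro conjI ballI)
    show "AE \<omega> in M. ?W \<omega> \<in> Hdot_dual G len \<phi> lam s"
      using summable by eventually_elim (rule coefficient_functional_in_dual)
    show "(\<lambda>\<omega>. ?W \<omega> \<psi>) \<in> borel_measurable M" for \<psi>
      by measurable
    have error: "noise_partial_sum G len \<phi> \<xi> n \<omega> (\<phi> i) - ?W \<omega> (\<phi> i) = (if i < n then 0 else - \<xi> i \<omega>)" for n \<omega> i
      unfolding noise_partial_sum_def coefficient_functional_basis
      by (simp add: orthonormal if_distrib cong: if_cong)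
    have norm: "(\<integral>\<^sup>+ \<omega>. ennreal ((Hdot_dual_norm \<phi> lam s
        (\<lambda>\<psi>. noise_partial_sum G len \<phi> \<xi> n \<omega> \<psi> - ?W \<omega> \<psi>))\<^sup>2) \<partial>M)
        = ennreal (\<Sum>i. if i < n then 0 else lam i powr (- s))" for n
      unfolding tail_moment[symmetric]
    proof (rule nn_integral_cong_AE, use summable in eventually_elim)
      case (elim \<omega>)
      have tail: "summable (\<lambda>i. if i < n then 0 else ?t i \<omega>)"
        by (rule summable_comparison_test'[OF elim]) auto
      have "(Hdot_dual_norm \<phi> lam s (\<lambda>\<psi>. noise_partial_sum G len \<phi> \<xi> n \<omega> \<psi> - ?W \<omega> \<psi>))\<^sup>2
          = (sqrt (\<Sum>i. if i < n then 0 else ?t i \<omega>))\<^sup>2"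
        unfolding Hdot_dual_norm_def error
        by (intro arg_cong[where f = "\<lambda>x. (sqrt x)\<^sup>2"] suminf_cong) simp
      also have "\<dots> = (\<Sum>i. if i < n then 0 else ?t i \<omega>)"
        using suminf_nonneg[OF tail] by simp
      finally show ?case
        using tail by (simp add: suminf_ennreal2)
    qed
    have "(\<lambda>n. ennreal (\<Sum>i. if i < n then 0 else lam i powr (- s))) \<longlonglongrightarrow> ennreal 0"
      by (intro tendsto_ennrealI suminf_tail_tendsto_0 summable_lam_powr s)
    then show "(\<lambda>n. \<integral>\<^sup>+ \<omega>. ennreal ((Hdot_dual_norm \<phi> lam s
        (\<lambda>\<psi>. noise_partial_sum G len \<phi> \<xi> n \<omega> \<psi> - ?W \<omega> \<psi>))\<^sup>2) \<partial>M) \<longlonglongrightarrow> 0"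
      unfolding norm by simp
  qed
qed


section \<open>Unique solvability\<close>

theorem proposition1:
  fixes G :: "('v, 'e) pre_digraph" and len :: "'e \<Rightarrow> real"
    and \<kappa> \<tau> \<alpha> :: real
    and \<phi> :: "nat \<Rightarrow> 'e graph_fun" and lam :: "nat \<Rightarrow> real"
    and M :: "'w measure" and \<xi> :: "nat \<Rightarrow> 'w \<Rightarrow> real"
  assumes "compact_metric_graph G len"
    and "\<kappa> > 0" and "\<tau> > 0"
    and "eigenbasis G len \<kappa> \<phi> lam"
    and "prob_space M" and "complete_measure M"
    and "prob_space.indep_vars M (\<lambda>_. borel) \<xi> UNIV"
    and "\<And>i. distributed M lborel (\<xi> i) std_normal_density"
    and "\<alpha> > 1 / 2"
  shows "AE \<omega> in M. \<exists>u\<in>L2 G len.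
           Hdot_dual_eq G len \<phi> lam \<alpha>
             (L_power_ext G len \<phi> lam (\<alpha> / 2) (\<lambda>e x. \<tau> * u e x)) (white_noise G len \<phi> lam M \<xi> \<omega>) \<and>
           (\<forall>v\<in>L2 G len.
              Hdot_dual_eq G len \<phi> lam \<alpha>
                (L_power_ext G len \<phi> lam (\<alpha> / 2) (\<lambda>e x. \<tau> * v e x)) (white_noise G len \<phi> lam M \<xi> \<omega>) \<longrightarrow>
              L2_eq G len v u)"
proof -
  interpret graph_eigenbasis G len \<kappa> \<phi> lam
    using assms(1,4) by (simp add: graph_eigenbasis_def graph_eigenbasis_axioms_def)
  have "\<xi> i \<in> borel_measurable M" for i
    using distributed_measurable[OF assms(8)[of i]] by simp
  then have "\<exists>W. \<forall>s>1/2. noise_tendsto G len \<phi> lam M \<xi> s W"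
    using noise_series_converges std_normal_second_moment assms(8) by blast
  then have "\<forall>s>1/2. noise_tendsto G len \<phi> lam M \<xi> s (white_noise G len \<phi> lam M \<xi>)"
    unfolding white_noise_def by (rule someI_ex)
  then have "AE \<omega> in M. white_noise G len \<phi> lam M \<xi> \<omega> \<in> Hdot_dual G len \<phi> lam \<alpha>"
    using \<open>\<alpha> > 1 / 2\<close> by (simp add: noise_tendsto_def)
  then show ?thesis
    by eventually_elim (rule fractional_equation_unique_solution, use \<open>\<tau> > 0\<close> in auto)
qed

end
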